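(* Let $A\in\mathbb{R}^{m\times n}$, $b\in\mathbb{R}^m$, $c\in\mathbb{R}^n$, $u\in\mathbb{R}^n$, and consider the linear program $\min\{c^\top x:\ Ax=b,\ 0\le x\le u\}$. Starting from any feasible solution $x^{(0)}$, the steepest-descent circuit augmentation algorithm terminates (with an optimal solution) within $O(n^2 m\,\kappa_A\log(\kappa_A+n))$ augmentations.
   Context: For a linear subspace $W\subseteq\mathbb{R}^n$, an elementary vector of $W$ is a nonzero $g\in W$ whose support is inclusion-minimal among nonzero vectors of $W$; $\mathcal F(W)$ is the set of elementary vectors. The fractional circuit imbalance measure is $\kappa_W=\max\{|g_j/g_i| : g\in\mathcal F(W),\ i,j\in\mathrm{supp}(g)\}$ for nontrivial $W$ ($\kappa_W=1$ for $W\in\{\{0\},\mathbb{R}^n\}$), and $\kappa_A:=\kappa_{\ker(A)}$. For a feasible $x$, an elementary vector $g\in\mathcal F(\ker(A))$ is an augmenting direction if $c^\top g<0$, $g_i\ge 0$ whenever $x_i=0$, and $g_i\le 0$ whenever $x_i=u_i$; $x$ is optimal iff no augmenting direction exists. The steepest-descent circuit augmentation algorithm, at the current feasible iterate $x^{(t)}$, stops if no augmenting direction exists; otherwise it selects an augmenting direction $g$ maximizing $-c^\top g/\|g\|_1$ and sets $x^{(t+1)}=x^{(t)}+\alpha g$ with $\alpha>0$ the largest value such that $x^{(t+1)}$ is feasible (a maximal augmentation). *)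

theory Defs
  imports Complex_Main "Jordan_Normal_Form.Matrix_Kernel"
begin

text \<open>Vectors and matrices over \<open>\<real>\<close> with explicit dimensions are used throughout, because the
  absolute constant hidden in an \<open>O\<close>-bound has to be quantified before the dimensions.\<close>

definition supp_vec :: "real vec \<Rightarrow> nat set" where
  "supp_vec v = {i. i < dim_vec v \<and> v $ i \<noteq> 0}"

definition l1_norm_vec :: "real vec \<Rightarrow> real" where
  "l1_norm_vec v = (\<Sum>i<dim_vec v. \<bar>v $ i\<bar>)"

definition elementary_vectors :: "real vec set \<Rightarrow> real vec set" where
  "elementary_vectors W = {g \<in> W. g \<noteq> 0\<^sub>v (dim_vec g) \<and>
     (\<forall>h\<in>W. h \<noteq> 0\<^sub>v (dim_vec h) \<longrightarrow> \<not> supp_vec h \<subset> supp_vec g)}"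

text \<open>For a linear subspace \<open>W\<close> of \<open>\<real>\<^sup>n\<close>, elementary vectors with the same support are proportional,
  so the set of ratios below is finite and its maximum exists.\<close>

definition circuit_imbalance :: "nat \<Rightarrow> real vec set \<Rightarrow> real" where
  "circuit_imbalance n W =
     (if W = {0\<^sub>v n} \<or> W = carrier_vec n then 1
      else Max {\<bar>g $ j / g $ i\<bar> | g i j.
                  g \<in> elementary_vectors W \<and> i \<in> supp_vec g \<and> j \<in> supp_vec g})"

definition circuit_imbalance_mat :: "real mat \<Rightarrow> real" where
  "circuit_imbalance_mat A = circuit_imbalance (dim_col A) (mat_kernel A)"

text \<open>The order on vectors is componentwise (and requires equal dimensions).\<close>

definition lp_feasible :: "real mat \<Rightarrow> real vec \<Rightarrow> real vec \<Rightarrow> real vec \<Rightarrow> bool" where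
  "lp_feasible A b u x \<longleftrightarrow>
     x \<in> carrier_vec (dim_col A) \<and> A *\<^sub>v x = b \<and> 0\<^sub>v (dim_col A) \<le> x \<and> x \<le> u"

definition lp_optimal :: "real mat \<Rightarrow> real vec \<Rightarrow> real vec \<Rightarrow> real vec \<Rightarrow> real vec \<Rightarrow> bool" where
  "lp_optimal A b c u x \<longleftrightarrow>
     lp_feasible A b u x \<and> (\<forall>y. lp_feasible A b u y \<longrightarrow> c \<bullet> x \<le> c \<bullet> y)"

definition augmenting_direction ::
  "real mat \<Rightarrow> real vec \<Rightarrow> real vec \<Rightarrow> real vec \<Rightarrow> real vec \<Rightarrow> bool" where
  "augmenting_direction A c u x g \<longleftrightarrow>
     g \<in> elementary_vectors (mat_kernel A) \<and> c \<bullet> g < 0 \<and>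
     (\<forall>i<dim_vec g. (x $ i = 0 \<longrightarrow> g $ i \<ge> 0) \<and> (x $ i = u $ i \<longrightarrow> g $ i \<le> 0))"

definition maximal_augmentation ::
  "real mat \<Rightarrow> real vec \<Rightarrow> real vec \<Rightarrow> real vec \<Rightarrow> real vec \<Rightarrow> real vec \<Rightarrow> bool" where
  "maximal_augmentation A b u x g y \<longleftrightarrow>
     (\<exists>\<alpha>>0. y = x + \<alpha> \<cdot>\<^sub>v g \<and> lp_feasible A b u y \<and>
        (\<forall>\<beta>>0. lp_feasible A b u (x + \<beta> \<cdot>\<^sub>v g) \<longrightarrow> \<beta> \<le> \<alpha>))"

text \<open>One iteration; a relation, since ties between steepest directions are broken arbitrarily.\<close>

definition steepest_descent_step ::
  "real mat \<Rightarrow> real vec \<Rightarrow> real vec \<Rightarrow> real vec \<Rightarrow> real vec \<Rightarrow> real vec \<Rightarrow> bool" where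
  "steepest_descent_step A b c u x y \<longleftrightarrow>
     (\<exists>g. is_arg_max (\<lambda>h. - (c \<bullet> h) / l1_norm_vec h) (augmenting_direction A c u x) g \<and>
          maximal_augmentation A b u x g y)"

text \<open>\<open>x 0, \<dots>, x T\<close> are the iterates of \<open>T\<close> augmentations; \<open>x t\<close> is irrelevant for \<open>t > T\<close>.\<close>

definition steepest_descent_run ::
  "real mat \<Rightarrow> real vec \<Rightarrow> real vec \<Rightarrow> real vec \<Rightarrow> (nat \<Rightarrow> real vec) \<Rightarrow> nat \<Rightarrow> bool" where
  "steepest_descent_run A b c u x T \<longleftrightarrow>
     (\<forall>t<T. steepest_descent_step A b c u (x t) (x (Suc t)))"

end

theory Submission
  imports Defs
begin

text \<open>The steepness \<open>\<epsilon>\<^sub>t = - c\<^sup>T g / \<parallel>g\<parallel>\<^sub>1\<close> of the chosen directions is analysed as in the minimum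
  mean cycle cancelling algorithm for min-cost flow. By linear programming duality \<open>\<epsilon>\<^sub>t\<close> is the least
  \<open>\<epsilon>\<close> for which some reduced cost vector \<open>s \<in> c + ker(A)\<^sup>\<bottom>\<close> is \<open>\<epsilon>\<close>-optimal for the current iterate, and
  it never increases. Among \<open>n + 1\<close> consecutive steps some direction uses a coordinate opposed to the
  sign pattern of the initial \<open>s\<close>, since otherwise each step would saturate a new coordinate; as
  elementary vectors have at most \<open>m + 1\<close> nonzero entries, this step is less steep by a factor
  \<open>1 - 1 / (1 + m \<kappa>)\<close>. Once \<open>\<epsilon>\<close> has dropped by more than \<open>2 n \<kappa>\<close>, which takes
  \<open>O(n m \<kappa> log(n \<kappa>))\<close> steps, a further coordinate is frozen for the rest of the run, and there are
  only \<open>n\<close> coordinates.\<close>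

section \<open>Conformal vectors and circuits\<close>

definition conformal :: "real vec \<Rightarrow> real vec \<Rightarrow> bool" where
  "conformal h v \<longleftrightarrow> (\<forall>i<dim_vec h. h $ i \<noteq> 0 \<longrightarrow> 0 < h $ i * v $ i)"

lemma conformal_trans:
  assumes "conformal g h" "conformal h v" "dim_vec g = dim_vec h"
  shows "conformal g v"
  unfolding conformal_def
proof (intro allI impI)
  fix i assume i: "i < dim_vec g" "g $ i \<noteq> 0"
  then have gh: "0 < g $ i * h $ i"
    using assms by (auto simp: conformal_def)
  then have "h $ i \<noteq> 0" by auto
  then have "0 < h $ i * v $ i"
    using assms i by (auto simp: conformal_def)
  with gh show "0 < g $ i * v $ i"
    by (auto simp: zero_less_mult_iff)
qed

lemma finite_supp_vec [simp]: "finite (supp_vec v)"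
  by (simp add: supp_vec_def)

lemma supp_vec_empty_iff:
  assumes "dim_vec v = n"
  shows "supp_vec v = {} \<longleftrightarrow> v = 0\<^sub>v n"
proof
  show "supp_vec v = {} \<Longrightarrow> v = 0\<^sub>v n"
    using assms by (intro eq_vecI) (auto simp: supp_vec_def)
  show "v = 0\<^sub>v n \<Longrightarrow> supp_vec v = {}"
    by (auto simp: supp_vec_def)
qed

lemma conformal_supp_subset:
  assumes "conformal h v" "dim_vec h = dim_vec v"
  shows "supp_vec h \<subseteq> supp_vec v"
  using assms by (fastforce simp: conformal_def supp_vec_def)

text \<open>Moving from \<open>v\<close> along \<open>h\<close> until the first opposed coordinate
  vanishes flips no sign and shrinks the support. The last conclusion lets a later induction keep a
  prescribed coordinate nonzero.\<close>

lemma conformal_reduction: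
  assumes v: "v \<in> carrier_vec n" and h: "h \<in> carrier_vec n"
    and sub: "supp_vec h \<subseteq> supp_vec v"
    and opp: "\<exists>j<n. h $ j * v $ j < 0"
  obtains \<mu> where "\<mu> > 0" "conformal (v + \<mu> \<cdot>\<^sub>v h) v"
    "supp_vec (v + \<mu> \<cdot>\<^sub>v h) \<subset> supp_vec v"
    "\<And>i. i \<in> supp_vec v \<Longrightarrow> h $ i * v $ i \<ge> 0 \<Longrightarrow> i \<in> supp_vec (v + \<mu> \<cdot>\<^sub>v h)"
proof -
  define J where "J = {j. j < n \<and> h $ j * v $ j < 0}"
  \<comment> \<open>Each ratio is the step at which one opposed coordinate reaches zero, so the
    minimum is the largest step that flips no sign.\<close>
  define R where "R = (\<lambda>j. - v $ j / h $ j) ` J"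
  define \<mu> where "\<mu> = Min R"
  let ?w = "v + \<mu> \<cdot>\<^sub>v h"
  have dims [simp]: "dim_vec v = n" "dim_vec h = n" using v h by auto
  have fin: "finite R" "R \<noteq> {}" using opp by (auto simp: J_def R_def)
  have pos: "- v $ j / h $ j > 0" if "j \<in> J" for j
    using that by (auto simp: J_def mult_less_0_iff divide_less_0_iff)
  obtain k where k: "k \<in> J" "\<mu> = - v $ k / h $ k"
    using Min_in[OF fin] by (auto simp: \<mu>_def R_def)
  have \<mu>: "\<mu> > 0" using pos[OF k(1)] k(2) by simp
  have w: "?w $ j = v $ j + \<mu> * h $ j" if "j < n" for j using that by simp
  have hz: "h $ j = 0" if "j < n" "v $ j = 0" for j
    using sub that by (auto simp: supp_vec_def)
  have wv: "?w $ j * v $ j = (v $ j)\<^sup>2 + \<mu> * (h $ j * v $ j)" if "j < n" for j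
    using that by (simp add: algebra_simps power2_eq_square)
  have nonneg: "?w $ j * v $ j \<ge> 0" if j: "j < n" for j
  proof (cases "j \<in> J")
    case True
    then have hn: "h $ j * v $ j < 0" by (simp add: J_def)
    have "\<mu> \<le> - v $ j / h $ j" using True fin by (auto simp: \<mu>_def R_def)
    then have "\<mu> * (h $ j * v $ j) \<ge> - v $ j / h $ j * (h $ j * v $ j)"
      using hn by (intro mult_right_mono_neg) auto
    also have "- v $ j / h $ j * (h $ j * v $ j) = - ((v $ j)\<^sup>2)"
      using hn by (auto simp: power2_eq_square)
    finally show ?thesis using wv[OF j] by simp
  next
    case False
    then have "h $ j * v $ j \<ge> 0" using j by (simp add: J_def)
    then show ?thesis using wv[OF j] \<mu> by simp
  qed
  have conf: "conformal ?w v"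
    unfolding conformal_def
  proof (intro allI impI)
    fix j assume j: "j < dim_vec ?w" "?w $ j \<noteq> 0"
    then have "j < n" by simp
    moreover have "v $ j \<noteq> 0" using j hz by auto
    ultimately show "0 < ?w $ j * v $ j" using nonneg[of j] j by (simp add: order_less_le)
  qed
  have "supp_vec ?w \<subseteq> supp_vec v" by (rule conformal_supp_subset[OF conf]) simp
  moreover have "k \<in> supp_vec v" "k \<notin> supp_vec ?w"
    using k by (auto simp: supp_vec_def J_def)
  ultimately have strict: "supp_vec ?w \<subset> supp_vec v" by blast
  have keep: "i \<in> supp_vec ?w" if i: "i \<in> supp_vec v" "h $ i * v $ i \<ge> 0" for i
  proof -
    have "i < n" "v $ i \<noteq> 0" using i by (auto simp: supp_vec_def)
    then have "?w $ i * v $ i > 0" using wv i \<mu> by (simp add: add_pos_nonneg)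
    then show ?thesis using \<open>i < n\<close> by (auto simp: supp_vec_def)
  qed
  show thesis using that[OF \<mu> conf strict keep] .
qed

section \<open>Linear subspaces and the structure of their elementary vectors\<close>

locale real_vec_subspace =
  fixes n :: nat and W :: "real vec set"
  assumes carrier: "W \<subseteq> carrier_vec n"
    and zero_mem: "0\<^sub>v n \<in> W"
    and add_mem: "v \<in> W \<Longrightarrow> w \<in> W \<Longrightarrow> v + w \<in> W"
    and smult_mem: "v \<in> W \<Longrightarrow> a \<cdot>\<^sub>v v \<in> W"
begin

lemma dim_mem: "v \<in> W \<Longrightarrow> dim_vec v = n"
  using carrier by auto

lemma elementary_iff:
  "g \<in> elementary_vectors W \<longleftrightarrow>
     g \<in> W \<and> supp_vec g \<noteq> {} \<and> (\<forall>h\<in>W. supp_vec h \<noteq> {} \<longrightarrow> \<not> supp_vec h \<subset> supp_vec g)"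
  unfolding elementary_vectors_def by (simp add: supp_vec_empty_iff[OF refl])

lemma elementaryD:
  assumes "g \<in> elementary_vectors W"
  shows "g \<in> W" "dim_vec g = n" "supp_vec g \<noteq> {}"
    "h \<in> W \<Longrightarrow> supp_vec h \<subset> supp_vec g \<Longrightarrow> supp_vec h = {}"
  using assms dim_mem unfolding elementary_iff by blast+

lemma smult_elementary:
  assumes g: "g \<in> elementary_vectors W" and a: "a \<noteq> 0"
  shows "a \<cdot>\<^sub>v g \<in> elementary_vectors W"
proof -
  have "supp_vec (a \<cdot>\<^sub>v g) = supp_vec g"
    using a by (auto simp: supp_vec_def)
  then show ?thesis
    using g smult_mem unfolding elementary_iff by simp
qed

text \<open>Cancelling coordinate \<open>i\<close> by a combination of \<open>g\<close> and
  \<open>h\<close> leaves a strictly smaller support, which minimality forces to be empty.\<close>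

lemma elementary_proportional:
  assumes g: "g \<in> elementary_vectors W" and h: "h \<in> elementary_vectors W"
    and supp: "supp_vec g = supp_vec h"
  obtains a where "a \<noteq> 0" "h = a \<cdot>\<^sub>v g"
proof -
  obtain i where i: "i \<in> supp_vec g" using elementaryD(3)[OF g] by blast
  note [simp] = elementaryD(2)[OF g] elementaryD(2)[OF h]
  have i': "i < n" "g $ i \<noteq> 0" "h $ i \<noteq> 0"
    using i i[unfolded supp] by (auto simp: supp_vec_def)
  define a where "a = h $ i / g $ i"
  have a: "a \<noteq> 0" using i' by (simp add: a_def)
  let ?w = "h + (- a) \<cdot>\<^sub>v g"
  have w: "?w \<in> W" using g h by (intro add_mem smult_mem elementaryD(1))
  have "h $ j = 0" if "j < n" "g $ j = 0" for j
  proof -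
    have "j \<notin> supp_vec g" using that by (simp add: supp_vec_def)
    then show ?thesis unfolding supp using that(1) by (simp add: supp_vec_def)
  qed
  then have "supp_vec ?w \<subseteq> supp_vec g" unfolding supp_vec_def by fastforce
  moreover have "i \<notin> supp_vec ?w" using i' by (auto simp: supp_vec_def a_def)
  ultimately have "supp_vec ?w \<subset> supp_vec g" using i by blast
  then have w0: "?w = 0\<^sub>v n"
    using elementaryD(4)[OF g w] supp_vec_empty_iff[OF dim_mem[OF w]] by blast
  have "h = a \<cdot>\<^sub>v g"
  proof (rule eq_vecI)
    fix j assume "j < dim_vec (a \<cdot>\<^sub>v g)"
    then have j: "j < n" by simp
    then have "?w $ j = 0" using w0 by simp
    then show "h $ j = (a \<cdot>\<^sub>v g) $ j" using j by simp
  qed simp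
  with a show thesis by (rule that)
qed

text \<open>There are finitely many supports, and elementary vectors of equal support are
  proportional. This serves both the imbalance ratios and the steepness values.\<close>

lemma finite_image_elementary:
  assumes inv: "\<And>g a. g \<in> elementary_vectors W \<Longrightarrow> a \<noteq> 0 \<Longrightarrow> F (a \<cdot>\<^sub>v g) = F g"
  shows "finite (F ` elementary_vectors W)"
proof (rule finite_subset)
  let ?rep = "\<lambda>S. SOME g. g \<in> elementary_vectors W \<and> supp_vec g = S"
  show "F ` elementary_vectors W \<subseteq> (F \<circ> ?rep) ` Pow {..<n}"
  proof
    fix y assume "y \<in> F ` elementary_vectors W"
    then obtain g where g: "g \<in> elementary_vectors W" "y = F g" by blast
    let ?r = "?rep (supp_vec g)"
    have r: "?r \<in> elementary_vectors W \<and> supp_vec ?r = supp_vec g"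
      by (rule someI[of _ g]) (use g in simp)
    then obtain a where "a \<noteq> 0" "g = a \<cdot>\<^sub>v ?r"
      using elementary_proportional[of ?r g] g by blast
    then have "F g = F ?r" using inv[of ?r a] r by simp
    moreover have "supp_vec g \<in> Pow {..<n}"
      using g elementaryD(2) by (auto simp: supp_vec_def)
    ultimately show "y \<in> (F \<circ> ?rep) ` Pow {..<n}"
      using g(2) by (auto simp: image_iff)
  qed
qed simp

text \<open>Induction on the support size. If \<open>v\<close> is not elementary, some
  \<open>h\<close> of smaller support either serves to reduce \<open>v\<close> or, up to sign, is
  conformal to \<open>v\<close> and replaces it; \<open>i\<close> stays in the support
  throughout.\<close>

lemma ex_conformal_elementary:
  assumes "v \<in> W" "i \<in> supp_vec v"
  obtains g where "g \<in> elementary_vectors W" "conformal g v" "i \<in> supp_vec g"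
proof -
  have "\<exists>g\<in>elementary_vectors W. conformal g v \<and> i \<in> supp_vec g"
    using assms
  proof (induction "card (supp_vec v)" arbitrary: v rule: less_induct)
    case less
    have vdim [simp]: "dim_vec v = n" using less.prems dim_mem by blast
    show ?case
    proof (cases "v \<in> elementary_vectors W")
      case True
      have "conformal v v" by (auto simp: conformal_def zero_less_mult_iff)
      with True less.prems show ?thesis by blast
    next
      case False
      obtain h where h: "h \<in> W" "supp_vec h \<noteq> {}" "supp_vec h \<subset> supp_vec v"
        using False less.prems unfolding elementary_iff by blast
      have neg: "- 1 \<cdot>\<^sub>v g \<in> W" "supp_vec (- 1 \<cdot>\<^sub>v g) = supp_vec g"
        "\<And>j. j < n \<Longrightarrow> (- 1 \<cdot>\<^sub>v g) $ j = - g $ j" if "g \<in> W" for g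
        using smult_mem[OF that] dim_mem[OF that] by (auto simp: supp_vec_def)
      have i: "i < n" "v $ i \<noteq> 0" using less.prems(2) by (auto simp: supp_vec_def)
      \<comment> \<open>This sign keeps \<open>k\<close> from opposing \<open>v\<close> at
        \<open>i\<close>, so \<open>i\<close> survives a reduction along \<open>k\<close>.\<close>
      define k where "k = (if h $ i * v $ i \<ge> 0 then h else - 1 \<cdot>\<^sub>v h)"
      have k: "k \<in> W" "supp_vec k = supp_vec h" "k $ i * v $ i \<ge> 0"
        using neg[OF h(1)] h(1) i by (auto simp: k_def)
      have opposed: ?thesis
        if w: "w \<in> W" "supp_vec w \<subset> supp_vec v" "w $ i * v $ i \<ge> 0" and opp: "\<exists>j<n. w $ j * v $ j < 0" for w
      proof -
        have "v \<in> carrier_vec n" "w \<in> carrier_vec n" using carrier w(1) less.prems(1) by auto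
        then obtain \<mu> where \<mu>: "conformal (v + \<mu> \<cdot>\<^sub>v w) v" "supp_vec (v + \<mu> \<cdot>\<^sub>v w) \<subset> supp_vec v"
            "i \<in> supp_vec (v + \<mu> \<cdot>\<^sub>v w)"
          using conformal_reduction[of v n w thesis] w less.prems(2) opp
          by (simp add: psubset_eq)
        have mem: "v + \<mu> \<cdot>\<^sub>v w \<in> W" using less.prems(1) w by (intro add_mem smult_mem)
        have "card (supp_vec (v + \<mu> \<cdot>\<^sub>v w)) < card (supp_vec v)"
          using \<mu>(2) by (intro psubset_card_mono) auto
        from less.hyps[OF this mem \<mu>(3)] obtain g where g: "g \<in> elementary_vectors W"
            "conformal g (v + \<mu> \<cdot>\<^sub>v w)" "i \<in> supp_vec g"
          by blast
        moreover have "conformal g v"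
          using conformal_trans[OF g(2) \<mu>(1)] elementaryD(2)[OF g(1)] dim_mem[OF mem] by simp
        ultimately show ?thesis by blast
      qed
      show ?thesis
      proof (cases "\<exists>j<n. k $ j * v $ j < 0")
        case True
        then show ?thesis using opposed[of k] k h by simp
      next
        case no_opp: False
        have kdim [simp]: "dim_vec k = n" using k dim_mem by blast
        have conf: "conformal k v"
          unfolding conformal_def
        proof (intro allI impI)
          fix j assume j: "j < dim_vec k" "k $ j \<noteq> 0"
          then have "j \<in> supp_vec v" using k h by (auto simp: supp_vec_def)
          then have "k $ j * v $ j \<noteq> 0" using j by (simp add: supp_vec_def)
          moreover have "\<not> k $ j * v $ j < 0" using no_opp j by simp
          ultimately show "0 < k $ j * v $ j" by linarith
        qed
        show ?thesis
        proof (cases "k $ i = 0")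
          \<comment> \<open>A conformal \<open>k\<close> that misses \<open>i\<close> cannot replace
            \<open>v\<close>. Its negative opposes \<open>v\<close> elsewhere and is zero at
            \<open>i\<close>, so the reduction applies to it.\<close>
          case True
          obtain j where "j \<in> supp_vec k" using k(2) h(2) by blast
          then have j: "j < n" "k $ j * v $ j > 0" using conf by (auto simp: supp_vec_def conformal_def)
          have "(- 1 \<cdot>\<^sub>v k) $ j * v $ j < 0" using neg(3)[OF k(1) j(1)] j by simp
          moreover have "supp_vec (- 1 \<cdot>\<^sub>v k) \<subset> supp_vec v"
            using neg(2)[OF k(1)] k(2) h(3) by simp
          moreover have "(- 1 \<cdot>\<^sub>v k) $ i * v $ i \<ge> 0"
            using neg(3)[OF k(1) i(1)] True by simp
          ultimately show ?thesis
            using opposed[OF neg(1)[OF k(1)]] j(1) by blast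
        next
          case False
          have "card (supp_vec k) < card (supp_vec v)"
            using k h by (intro psubset_card_mono) auto
          moreover have "i \<in> supp_vec k" using False i by (simp add: supp_vec_def)
          ultimately obtain g where g: "g \<in> elementary_vectors W" "conformal g k" "i \<in> supp_vec g"
            using less.hyps[OF _ k(1)] by blast
          moreover have "conformal g v"
            using conformal_trans[OF g(2) conf] elementaryD(2)[OF g(1)] by simp
          ultimately show ?thesis by blast
        qed
      qed
    qed
  qed
  then show thesis using that by blast
qed

end

section \<open>Duality for subspaces and boxes\<close>

text \<open>For \<open>- b \<le> a\<close> this is the support function of the interval from
  \<open>- b\<close> to \<open>a\<close>: the largest \<open>s * t\<close> over all \<open>s\<close>
  in it.\<close>

definition box_support :: "real \<Rightarrow> real \<Rightarrow> real \<Rightarrow> real" where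
  "box_support a b t = max (a * t) (- (b * t))"

lemma box_support_nonneg: "0 \<le> a \<Longrightarrow> 0 \<le> b \<Longrightarrow> 0 \<le> box_support a b t"
  by (cases "t \<ge> 0") (auto simp: box_support_def le_max_iff_disj mult_nonneg_nonpos)

lemma box_support_nonneg_arg:
  assumes "0 \<le> a" "0 \<le> b" "0 \<le> t"
  shows "box_support a b t = a * t"
proof -
  have "a * t \<ge> 0" "b * t \<ge> 0" using assms by auto
  then show ?thesis unfolding box_support_def by linarith
qed

lemma box_support_nonpos_arg:
  assumes "0 \<le> a" "0 \<le> b" "t \<le> 0"
  shows "box_support a b t = - (b * t)"
proof -
  have "a * t \<le> 0" "b * t \<le> 0" using assms by (auto simp: mult_nonneg_nonpos)
  then show ?thesis unfolding box_support_def by linarith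
qed

lemma box_support_add_le: "box_support a b (s + t) \<le> box_support a b s + box_support a b t"
  unfolding box_support_def distrib_left by linarith

lemma box_support_scale: "0 \<le> r \<Longrightarrow> box_support a b (r * t) = r * box_support a b t"
  by (simp add: box_support_def max_mult_distrib_left mult.left_commute)

text \<open>The function is linear on each half-line, so subadditivity becomes equality when the
  arguments do not disagree in sign.\<close>

lemma box_support_add_eq:
  assumes "0 \<le> a" "0 \<le> b" "s * t \<ge> 0"
  shows "box_support a b (s + t) = box_support a b s + box_support a b t"
proof -
  consider "s \<ge> 0" "t \<ge> 0" | "s \<le> 0" "t \<le> 0"
    using assms(3) by (auto simp: zero_le_mult_iff)
  then show ?thesis
    by cases (simp_all add: box_support_nonneg_arg box_support_nonpos_arg assms algebra_simps)
qed

lemma scalar_prod_sum: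
  "dim_vec v = n \<Longrightarrow> c \<bullet> v = (\<Sum>i<n. c $ i * v $ i)"
  by (simp add: scalar_prod_def atLeast0LessThan)

section \<open>From bounds on circuits to multipliers on the whole subspace\<close>

context real_vec_subspace
begin

text \<open>Conformal circuits are peeled off \<open>v\<close> one at a time; the right-hand side is
  additive along the way because the summands never disagree in sign. Assuming the bound for
  conformal circuits only makes it applicable to differences of feasible points.\<close>

lemma conformal_bound:
  assumes ab: "\<And>i. i < n \<Longrightarrow> 0 \<le> a i" "\<And>i. i < n \<Longrightarrow> 0 \<le> b i"
    and bound: "\<And>h. h \<in> elementary_vectors W \<Longrightarrow> conformal h v \<Longrightarrow>
      (\<Sum>i<n. d i * h $ i) \<le> (\<Sum>i<n. box_support (a i) (b i) (h $ i))"
    and v: "v \<in> W"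
  shows "(\<Sum>i<n. d i * v $ i) \<le> (\<Sum>i<n. box_support (a i) (b i) (v $ i))"
  using v bound
proof (induction "card (supp_vec v)" arbitrary: v rule: less_induct)
  case less
  have vdim [simp]: "dim_vec v = n" using less.prems dim_mem by blast
  show ?case
  proof (cases "supp_vec v = {}")
    case True
    then have "v = 0\<^sub>v n" using supp_vec_empty_iff[OF vdim] by blast
    then show ?thesis by (simp add: box_support_def)
  next
    case False
    then obtain i where i: "i \<in> supp_vec v" by blast
    then obtain g where g: "g \<in> elementary_vectors W" "conformal g v" "i \<in> supp_vec g"
      using ex_conformal_elementary less.prems(1) by metis
    have gdim [simp]: "dim_vec g = n" using elementaryD(2) g(1) by blast
    have gv: "g $ j * v $ j \<ge> 0" if "j < n" for j
      using g(2) that by (cases "g $ j = 0") (auto simp: conformal_def less_imp_le)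
    have "i < n" "g $ i * v $ i > 0" using g by (auto simp: conformal_def supp_vec_def)
    moreover have "(- 1 \<cdot>\<^sub>v g) $ i * v $ i = - (g $ i * v $ i)" using \<open>i < n\<close> by simp
    \<comment> \<open>Reducing along the negative of \<open>g\<close> splits \<open>v\<close> into a
      remainder \<open>w\<close> and a positive multiple of \<open>g\<close>, both conformal to
      \<open>v\<close>.\<close>
    ultimately have opp: "\<exists>j<n. (- 1 \<cdot>\<^sub>v g) $ j * v $ j < 0" by (metis neg_less_0_iff_less)
    have "supp_vec (- 1 \<cdot>\<^sub>v g) \<subseteq> supp_vec v"
      using conformal_supp_subset[OF g(2)] by (auto simp: supp_vec_def)
    then obtain \<mu> where \<mu>: "\<mu> > 0" "conformal (v + \<mu> \<cdot>\<^sub>v (- 1 \<cdot>\<^sub>v g)) v"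
        "supp_vec (v + \<mu> \<cdot>\<^sub>v (- 1 \<cdot>\<^sub>v g)) \<subset> supp_vec v"
      by (rule conformal_reduction[of v n "- 1 \<cdot>\<^sub>v g", rotated 2, OF _ opp])
         (simp_all add: carrier_vecI)
    define w where "w = v + \<mu> \<cdot>\<^sub>v (- 1 \<cdot>\<^sub>v g)"
    have w: "w \<in> W" unfolding w_def using less.prems(1) elementaryD(1)[OF g(1)]
      by (intro add_mem smult_mem)
    have wdim [simp]: "dim_vec w = n" using dim_mem[OF w] .
    have vw: "v $ j = w $ j + \<mu> * g $ j" if "j < n" for j
      using that by (simp add: w_def)
    have card: "card (supp_vec w) < card (supp_vec v)"
      using \<mu>(3) unfolding w_def by (intro psubset_card_mono) auto
    have IH: "(\<Sum>i<n. d i * w $ i) \<le> (\<Sum>i<n. box_support (a i) (b i) (w $ i))"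
    proof (rule less.hyps[OF card w])
      fix h assume h: "h \<in> elementary_vectors W" "conformal h w"
      have "conformal h v"
        using conformal_trans[OF h(2) \<mu>(2)[folded w_def]] elementaryD(2)[OF h(1)] by simp
      then show "(\<Sum>i<n. d i * h $ i) \<le> (\<Sum>i<n. box_support (a i) (b i) (h $ i))"
        using less.prems(2) h by blast
    qed
    have wg: "w $ j * (\<mu> * g $ j) \<ge> 0" if j: "j < n" for j
    proof (cases "w $ j = 0")
      case False
      then have "w $ j * v $ j > 0" using \<mu>(2) j unfolding w_def[symmetric] conformal_def by simp
      with gv[OF j] have "w $ j * g $ j \<ge> 0"
        by (smt (verit) mult_less_0_iff zero_less_mult_iff mult_nonneg_nonneg mult_nonpos_nonpos)
      then show ?thesis using \<mu>(1) by (simp add: mult.left_commute)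
    qed simp
    have "(\<Sum>i<n. d i * v $ i) = (\<Sum>i<n. d i * w $ i) + \<mu> * (\<Sum>i<n. d i * g $ i)"
    proof -
      have "(\<Sum>i<n. d i * v $ i) = (\<Sum>i<n. d i * (w $ i + \<mu> * g $ i))"
        by (intro sum.cong) (simp_all add: vw)
      then show ?thesis
        by (simp add: distrib_left sum.distrib sum_distrib_left mult.left_commute)
    qed
    also have "\<dots> \<le> (\<Sum>i<n. box_support (a i) (b i) (w $ i))
        + \<mu> * (\<Sum>i<n. box_support (a i) (b i) (g $ i))"
      using IH less.prems(2)[OF g(1,2)] \<mu>(1) by (intro add_mono mult_left_mono) auto
    also have "\<dots> = (\<Sum>i<n. box_support (a i) (b i) (w $ i) + box_support (a i) (b i) (\<mu> * g $ i))"
      using \<mu>(1) by (simp add: sum.distrib sum_distrib_left box_support_scale)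
    also have "\<dots> = (\<Sum>i<n. box_support (a i) (b i) (v $ i))"
      by (intro sum.cong) (simp_all add: vw box_support_add_eq ab wg)
    finally show ?thesis .
  qed
qed

text \<open>A Hahn-Banach argument: the multipliers are chosen one coordinate at a time, keeping the
  remaining coordinates dominated by the support function of the box.\<close>

lemma box_dual:
  assumes ab: "\<And>i. i < n \<Longrightarrow> - b i \<le> a i"
    and bound: "\<And>w. w \<in> W \<Longrightarrow> (\<Sum>i<n. d i * w $ i) \<le> (\<Sum>i<n. box_support (a i) (b i) (w $ i))"
  obtains s where "\<And>i. i < n \<Longrightarrow> - b i \<le> s i \<and> s i \<le> a i"
    and "\<And>w. w \<in> W \<Longrightarrow> (\<Sum>i<n. d i * w $ i) = (\<Sum>i<n. s i * w $ i)"
proof -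
  let ?D = "\<lambda>w. \<Sum>i<n. d i * w $ i"
  let ?p = "\<lambda>i w. box_support (a i) (b i) (w $ i)"
  have Dadd: "?D (v + w) = ?D v + ?D w" if "v \<in> W" "w \<in> W" for v w
    using dim_mem[OF that(1)] dim_mem[OF that(2)] by (simp add: distrib_left sum.distrib)
  have Dscale: "?D (r \<cdot>\<^sub>v w) = r * ?D w" if "w \<in> W" for r w
    using dim_mem[OF that] by (simp add: sum_distrib_left mult.left_commute)
  have partial: "\<exists>s. (\<forall>i<k. - b i \<le> s i \<and> s i \<le> a i) \<and>
      (\<forall>w\<in>W. ?D w - (\<Sum>i<k. s i * w $ i) \<le> (\<Sum>i\<in>{k..<n}. ?p i w))" if "k \<le> n" for k
    using that
  proof (induction k)
    case 0
    then show ?case using bound by (simp add: atLeast0LessThan)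
  next
    case (Suc k)
    then obtain s where s: "\<And>i. i < k \<Longrightarrow> - b i \<le> s i \<and> s i \<le> a i"
      and sW: "\<And>w. w \<in> W \<Longrightarrow> ?D w - (\<Sum>i<k. s i * w $ i) \<le> (\<Sum>i\<in>{k..<n}. ?p i w)"
      by auto
    have kn: "k < n" using Suc.prems by simp
    define R where "R w = ?D w - (\<Sum>i<k. s i * w $ i)" for w
    define P where "P w = (\<Sum>i\<in>{Suc k..<n}. ?p i w)" for w
    have RP: "R w \<le> ?p k w + P w" if "w \<in> W" for w
      using sW[OF that] kn by (simp add: R_def P_def sum.atLeast_Suc_lessThan)
    have Radd: "R (v + w) = R v + R w" if "v \<in> W" "w \<in> W" for v w
      using Dadd[OF that] dim_mem[OF that(1)] dim_mem[OF that(2)] kn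
      by (simp add: R_def distrib_left sum.distrib)
    have Rscale: "R (r \<cdot>\<^sub>v w) = r * R w" if "w \<in> W" for r w
      using Dscale[OF that] dim_mem[OF that] kn
      by (simp add: R_def right_diff_distrib sum_distrib_left mult.left_commute)
    have Padd: "P (v + w) \<le> P v + P w" if "v \<in> W" "w \<in> W" for v w
      using dim_mem[OF that(1)] dim_mem[OF that(2)]
      unfolding P_def sum.distrib[symmetric] by (intro sum_mono) (simp add: box_support_add_le)
    have Pscale: "P (r \<cdot>\<^sub>v w) = r * P w" if "w \<in> W" "r \<ge> 0" for r w
      using dim_mem[OF that(1)] that(2) by (simp add: P_def sum_distrib_left box_support_scale)
    \<comment> \<open>The new multiplier must be at least \<open>R w - P w\<close> whenever
      \<open>w $ k = 1\<close> and at most \<open>P w - R w\<close> whenever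
      \<open>w $ k = - 1\<close>. The supremum of the first kind works; the extra element
      \<open>- b k\<close> makes the set nonempty and enforces the lower side of the box.\<close>
    define X where "X = insert (- b k) {R w - P w | w. w \<in> W \<and> w $ k = 1}"
    define \<sigma> where "\<sigma> = Sup X"
    have pk: "box_support (a k) (b k) 1 = a k" "box_support (a k) (b k) (- 1) = b k"
      using ab[OF kn] by (auto simp: box_support_def)
    have Xa: "y \<le> a k" if "y \<in> X" for y
      using that RP ab[OF kn] pk(1) by (fastforce simp: X_def)
    have bdd: "bdd_above X" using Xa by (rule bdd_aboveI)
    have \<sigma>a: "\<sigma> \<le> a k" unfolding \<sigma>_def using Xa by (intro cSup_least) (auto simp: X_def)
    have \<sigma>b: "- b k \<le> \<sigma>" unfolding \<sigma>_def using bdd by (intro cSup_upper) (auto simp: X_def)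
    have up: "R w - P w \<le> \<sigma>" if "w \<in> W" "w $ k = 1" for w
      unfolding \<sigma>_def using bdd that by (intro cSup_upper) (auto simp: X_def)
    have low: "\<sigma> \<le> P w - R w" if w: "w \<in> W" "w $ k = - 1" for w
      unfolding \<sigma>_def
    proof (rule cSup_least)
      fix y assume "y \<in> X"
      then consider "y = - b k" | v where "y = R v - P v" "v \<in> W" "v $ k = 1"
        by (auto simp: X_def)
      then show "y \<le> P w - R w"
      proof cases
        case 1
        then show ?thesis using RP[OF w(1)] w(2) pk(2) by simp
      next
        case 2
        have "(v + w) $ k = 0" using 2 w dim_mem[OF w(1)] dim_mem[OF 2(2)] kn by simp
        then have "R (v + w) \<le> P (v + w)"
          using RP[OF add_mem[OF 2(2) w(1)]] by (simp add: box_support_def)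
        then show ?thesis using Radd[OF 2(2) w(1)] Padd[OF 2(2) w(1)] 2(1) by simp
      qed
    qed (auto simp: X_def)
    \<comment> \<open>By positive homogeneity, vectors with nonzero coordinate \<open>k\<close> are
      rescaled to have it equal to 1 or -1.\<close>
    have key: "R w - \<sigma> * w $ k \<le> P w" if w: "w \<in> W" for w
    proof -
      have idx: "(r \<cdot>\<^sub>v w) $ k = r * w $ k" for r using dim_mem[OF w] kn by simp
      consider "w $ k = 0" | "w $ k > 0" | "w $ k < 0" by linarith
      then show ?thesis
      proof cases
        case 1
        then show ?thesis using RP[OF w] by (simp add: box_support_def)
      next
        case 2
        have "R (inverse (w $ k) \<cdot>\<^sub>v w) - P (inverse (w $ k) \<cdot>\<^sub>v w) \<le> \<sigma>"
          using 2 by (intro up smult_mem w) (simp add: idx)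
        then have "inverse (w $ k) * (R w - P w) \<le> \<sigma>"
          using 2 by (simp add: Rscale[OF w] Pscale[OF w] right_diff_distrib)
        then have "R w - P w \<le> \<sigma> * w $ k" using 2 by (simp add: field_simps)
        then show ?thesis by simp
      next
        case 3
        have "\<sigma> \<le> P (- inverse (w $ k) \<cdot>\<^sub>v w) - R (- inverse (w $ k) \<cdot>\<^sub>v w)"
          using 3 by (intro low smult_mem w) (simp add: idx)
        then have "\<sigma> \<le> - inverse (w $ k) * (P w - R w)"
          using 3 by (simp add: Rscale[OF w] Pscale[OF w] right_diff_distrib)
        then have "\<sigma> * (- w $ k) \<le> P w - R w" using 3 by (simp add: field_simps)
        then show ?thesis by simp
      qed
    qed
    show ?case
    proof (intro exI conjI allI impI ballI)
      let ?s = "s(k := \<sigma>)"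
      fix i assume "i < Suc k"
      then show "- b i \<le> ?s i" "?s i \<le> a i" using s \<sigma>a \<sigma>b by (auto simp: less_Suc_eq)
    next
      fix w assume "w \<in> W"
      then show "?D w - (\<Sum>i<Suc k. (s(k := \<sigma>)) i * w $ i) \<le> (\<Sum>i\<in>{Suc k..<n}. ?p i w)"
        using key[of w] by (simp add: R_def P_def)
    qed
  qed
  obtain s where s: "\<And>i. i < n \<Longrightarrow> - b i \<le> s i \<and> s i \<le> a i"
    and le: "\<And>w. w \<in> W \<Longrightarrow> ?D w \<le> (\<Sum>i<n. s i * w $ i)"
    using partial[of n] by auto
  show thesis
  proof (rule that[OF s])
    fix w assume w: "w \<in> W"
    have "?D (- 1 \<cdot>\<^sub>v w) = - ?D w" using Dscale[OF w, of "- 1"] by simp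
    moreover have "(\<Sum>i<n. s i * (- 1 \<cdot>\<^sub>v w) $ i) = - (\<Sum>i<n. s i * w $ i)"
      using dim_mem[OF w] by (simp add: sum_negf)
    ultimately show "?D w = (\<Sum>i<n. s i * w $ i)"
      using le[OF w] le[OF smult_mem[OF w, of "- 1"]] by linarith
  qed
qed

end

section \<open>Support size and imbalance of circuits\<close>

text \<open>Induction on the number of equations. Two solutions \<open>f\<close> and
  \<open>h\<close> of the first \<open>k\<close> equations are combined so that equation
  \<open>k\<close> cancels, unless \<open>h\<close> already satisfies it.\<close>

lemma ex_nonzero_solution:
  fixes r :: "nat \<Rightarrow> nat \<Rightarrow> real"
  assumes "S \<subseteq> {..<n}" "k < card S"
  shows "\<exists>h. (\<exists>i. h i \<noteq> 0) \<and> (\<forall>i. i \<notin> S \<longrightarrow> h i = 0) \<and> (\<forall>j<k. (\<Sum>i<n. r j i * h i) = 0)"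
  using assms
proof (induction k arbitrary: S)
  case 0
  then obtain i where "i \<in> S" by fastforce
  then show ?case by (intro exI[of _ "\<lambda>j. if j = i then 1 else 0"]) auto
next
  case (Suc k)
  let ?L = "\<lambda>j h. \<Sum>i<n. r j i * h i"
  have fin: "finite S" using Suc.prems(1) finite_subset by blast
  have sub: "\<exists>h. (\<exists>i. h i \<noteq> 0) \<and> (\<forall>i. i \<notin> S - {p} \<longrightarrow> h i = 0) \<and> (\<forall>j<k. ?L j h = 0)"
    if "p \<in> S" for p
    using Suc.prems fin that by (intro Suc.IH) auto
  have "card S > 0" using Suc.prems(2) by linarith
  then obtain p where "p \<in> S" by (metis card.empty equals0I less_irrefl)
  from sub[OF this] obtain f q where f: "f q \<noteq> 0" "\<And>i. i \<notin> S \<Longrightarrow> f i = 0" "\<And>j. j < k \<Longrightarrow> ?L j f = 0"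
    by blast
  \<comment> \<open>Making \<open>h\<close> vanish at \<open>q\<close>, where \<open>f\<close> does
    not, keeps the combination nonzero.\<close>
  have "q \<in> S" using f by blast
  from sub[OF this] obtain h where h: "\<exists>i. h i \<noteq> 0" "\<And>i. i \<notin> S - {q} \<Longrightarrow> h i = 0"
      "\<And>j. j < k \<Longrightarrow> ?L j h = 0"
    by blast
  show ?case
  proof (cases "?L k h = 0")
    case True
    then show ?thesis using h by (intro exI[of _ h]) (auto simp: less_Suc_eq)
  next
    case False
    let ?g = "\<lambda>i. ?L k h * f i - ?L k f * h i"
    have "?L j ?g = ?L k h * ?L j f - ?L k f * ?L j h" for j
    proof -
      have "?L j ?g = (\<Sum>i<n. ?L k h * (r j i * f i) - ?L k f * (r j i * h i))"
        by (intro sum.cong refl) (simp only: right_diff_distrib mult.left_commute)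
      then show ?thesis by (simp only: sum_subtractf sum_distrib_left)
    qed
    then have "\<forall>j<Suc k. ?L j ?g = 0" using f(3) h(3) by (simp add: less_Suc_eq)
    moreover have "?g q \<noteq> 0" using False f(1) h(2)[of q] by simp
    moreover have "\<forall>i. i \<notin> S \<longrightarrow> ?g i = 0" using f(2) h(2) by simp
    ultimately show ?thesis by (intro exI[of _ ?g] conjI) (rule exI[of _ q])
  qed
qed

lemma real_vec_subspace_kernel:
  assumes A: "A \<in> carrier_mat m n"
  shows "real_vec_subspace n (mat_kernel (A :: real mat))"
proof
  show "mat_kernel A \<subseteq> carrier_vec n" using mat_kernelD[OF A] by blast
  show "0\<^sub>v n \<in> mat_kernel A" using A by (intro mat_kernelI[OF A]) auto
  show "v + w \<in> mat_kernel A" if "v \<in> mat_kernel A" "w \<in> mat_kernel A" for v w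
    using mat_kernelD[OF A that(1)] mat_kernelD[OF A that(2)]
    by (intro mat_kernelI[OF A]) (simp_all add: mult_add_distrib_mat_vec[OF A])
  show "a \<cdot>\<^sub>v v \<in> mat_kernel A" if "v \<in> mat_kernel A" for v a
    using mat_kernelD[OF A that] by (intro mat_kernelI[OF A]) (auto simp: mult_mat_vec[OF A])
qed

text \<open>Otherwise more than \<open>m\<close> columns remain after removing one index of the
  support. Their linear dependence is a nonzero kernel vector of strictly smaller support.\<close>

lemma card_supp_elementary_kernel:
  assumes A: "A \<in> carrier_mat m n" and g: "g \<in> elementary_vectors (mat_kernel A)"
  shows "card (supp_vec g) \<le> Suc m"
proof (rule ccontr)
  interpret real_vec_subspace n "mat_kernel A" by (rule real_vec_subspace_kernel[OF A])
  assume "\<not> card (supp_vec g) \<le> Suc m"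
  then have big: "Suc m < card (supp_vec g)" by simp
  obtain i where i: "i \<in> supp_vec g" using elementaryD(3)[OF g] by blast
  have "supp_vec g - {i} \<subseteq> {..<n}" "m < card (supp_vec g - {i})"
    using elementaryD(2)[OF g] big i by (auto simp: supp_vec_def)
  from ex_nonzero_solution[OF this, of "\<lambda>j k. A $$ (j, k)"]
  obtain h p where h: "h p \<noteq> 0" "\<And>k. k \<notin> supp_vec g - {i} \<Longrightarrow> h k = 0"
      "\<And>j. j < m \<Longrightarrow> (\<Sum>k<n. A $$ (j, k) * h k) = 0"
    by blast
  have pn: "p < n" using h(1,2) elementaryD(2)[OF g] by (auto simp: supp_vec_def)
  have "A *\<^sub>v vec n h = 0\<^sub>v m"
    using A h(3) by (intro eq_vecI) (auto simp: scalar_prod_def atLeast0LessThan)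
  then have "vec n h \<in> mat_kernel A" by (intro mat_kernelI[OF A]) auto
  moreover have "supp_vec (vec n h) \<subset> supp_vec g"
  proof -
    have "supp_vec (vec n h) \<subseteq> {k. h k \<noteq> 0}" by (auto simp: supp_vec_def)
    then show ?thesis using h(2) i by blast
  qed
  ultimately have "supp_vec (vec n h) = {}" using elementaryD(4)[OF g] by blast
  moreover have "p \<in> supp_vec (vec n h)" using h(1) pn by (simp add: supp_vec_def)
  ultimately show False by blast
qed

section \<open>Comparing the entries of an elementary vector\<close>

context real_vec_subspace
begin

lemma ex_elementary:
  assumes "W \<noteq> {0\<^sub>v n}"
  obtains g where "g \<in> elementary_vectors W"
proof -
  obtain v where v: "v \<in> W" "v \<noteq> 0\<^sub>v n" using assms zero_mem by blast
  then obtain i where "i \<in> supp_vec v" using supp_vec_empty_iff[OF dim_mem[OF v(1)]] by blast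
  then show thesis using ex_conformal_elementary v(1) that by blast
qed

text \<open>Unit vectors leave no room for larger minimal supports; hence the value 1 prescribed for
  the full space also bounds the ratios there.\<close>

lemma supp_elementary_full:
  assumes W: "W = carrier_vec n" and g: "g \<in> elementary_vectors W"
    and i: "i \<in> supp_vec g" and j: "j \<in> supp_vec g"
  shows "i = j"
proof (rule ccontr)
  assume ne: "i \<noteq> j"
  have "i < n" using i elementaryD(2)[OF g] by (simp add: supp_vec_def)
  then have supp: "supp_vec (unit_vec n i) = {i}" 
    by (auto simp: supp_vec_def unit_vec_def split: if_splits)
  have "unit_vec n i \<in> W" using W by simp
  moreover have "supp_vec (unit_vec n i) \<subset> supp_vec g" using supp i j ne by auto
  ultimately show False using elementaryD(4)[OF g] supp by blast
qed

text \<open>Ratios are unchanged by scaling. Finiteness is what makes \<open>Max\<close> in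
  \<open>circuit_imbalance\<close> an upper bound.\<close>

lemma finite_imbalances:
  "finite {\<bar>g $ j / g $ i\<bar> | g i j. g \<in> elementary_vectors W \<and> i \<in> supp_vec g \<and> j \<in> supp_vec g}"
proof -
  define F where "F g = (\<lambda>(i, j). \<bar>g $ j / g $ i\<bar>) ` (supp_vec g \<times> supp_vec g)" for g :: "real vec"
  have "finite (F ` elementary_vectors W)"
  proof (rule finite_image_elementary)
    fix g :: "real vec" and a :: real
    assume a: "a \<noteq> 0"
    have "supp_vec (a \<cdot>\<^sub>v g) = supp_vec g" using a by (auto simp: supp_vec_def)
    then have "F (a \<cdot>\<^sub>v g) = (\<lambda>(i, j). \<bar>(a \<cdot>\<^sub>v g) $ j / (a \<cdot>\<^sub>v g) $ i\<bar>) ` (supp_vec g \<times> supp_vec g)"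
      by (simp only: F_def)
    also have "\<dots> = F g"
      unfolding F_def by (rule image_cong[OF refl]) (use a in \<open>clarsimp simp: supp_vec_def abs_mult\<close>)
    finally show "F (a \<cdot>\<^sub>v g) = F g" .
  qed
  then have "finite (\<Union> (F ` elementary_vectors W))"
    by (rule finite_Union) (auto simp: F_def)
  moreover have "\<bar>g $ j / g $ i\<bar> \<in> F g" if "i \<in> supp_vec g" "j \<in> supp_vec g" for g i j
    unfolding F_def using that by (intro image_eqI[of _ _ "(i, j)"]) auto
  ultimately show ?thesis by (elim finite_subset[rotated]) blast
qed

lemma circuit_imbalance_ratio:
  assumes g: "g \<in> elementary_vectors W" and i: "i \<in> supp_vec g" and j: "j \<in> supp_vec g"
  shows "\<bar>g $ j\<bar> \<le> circuit_imbalance n W * \<bar>g $ i\<bar>"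
proof -
  have gi: "g $ i \<noteq> 0" using i by (simp add: supp_vec_def)
  consider (zero) "W = {0\<^sub>v n}" | (full) "W = carrier_vec n" | (proper) "W \<noteq> {0\<^sub>v n}" "W \<noteq> carrier_vec n"
    by blast
  then show ?thesis
  proof cases
    case zero
    then have "g = 0\<^sub>v n" using elementaryD(1)[OF g] by blast
    then show ?thesis using elementaryD(3)[OF g] supp_vec_empty_iff[OF elementaryD(2)[OF g]] by blast
  next
    case full
    then show ?thesis
      using supp_elementary_full[OF full g i j] by (simp add: circuit_imbalance_def)
  next
    case proper
    have "\<bar>g $ j / g $ i\<bar> \<le> circuit_imbalance n W"
      unfolding circuit_imbalance_def using proper g i j
      by (simp only: if_False simp_thms) (intro Max_ge[OF finite_imbalances], blast)
    then show ?thesis using gi by (simp add: field_simps)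
  qed
qed

lemma circuit_imbalance_ge_1: "1 \<le> circuit_imbalance n W"
proof (cases "W = {0\<^sub>v n}")
  case False
  then obtain g where g: "g \<in> elementary_vectors W" by (rule ex_elementary)
  then obtain i where i: "i \<in> supp_vec g" using elementaryD(3) by blast
  then show ?thesis
    using circuit_imbalance_ratio[OF g i i] by (simp add: supp_vec_def)
qed (simp add: circuit_imbalance_def)

text \<open>Each of the at most \<open>N\<close> other entries is within the imbalance factor of
  entry \<open>i\<close>, which itself counts once. For a kernel, \<open>N\<close> will be the
  number of rows.\<close>

lemma l1_norm_elementary_le:
  assumes g: "g \<in> elementary_vectors W" and i: "i \<in> supp_vec g" and N: "card (supp_vec g) \<le> Suc N"
  shows "l1_norm_vec g \<le> (1 + real N * circuit_imbalance n W) * \<bar>g $ i\<bar>"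
proof -
  let ?k = "circuit_imbalance n W"
  have "l1_norm_vec g = (\<Sum>j\<in>supp_vec g. \<bar>g $ j\<bar>)"
    unfolding l1_norm_vec_def by (rule sum.mono_neutral_right) (auto simp: supp_vec_def)
  also have "\<dots> = \<bar>g $ i\<bar> + (\<Sum>j\<in>supp_vec g - {i}. \<bar>g $ j\<bar>)"
    using i by (simp add: sum.remove)
  also have "(\<Sum>j\<in>supp_vec g - {i}. \<bar>g $ j\<bar>) \<le> real (card (supp_vec g - {i})) * (?k * \<bar>g $ i\<bar>)"
    by (intro sum_bounded_above circuit_imbalance_ratio g i) auto
  also have "\<dots> \<le> real N * (?k * \<bar>g $ i\<bar>)"
    using N i circuit_imbalance_ge_1 by (intro mult_right_mono) auto
  finally show ?thesis by (simp add: algebra_simps)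
qed

lemma l1_norm_elementary_le_dim:
  assumes g: "g \<in> elementary_vectors W" and i: "i \<in> supp_vec g"
  shows "l1_norm_vec g \<le> real n * circuit_imbalance n W * \<bar>g $ i\<bar>"
proof -
  have "card (supp_vec g) \<le> card {..<n}"
    using elementaryD(2)[OF g] by (intro card_mono) (auto simp: supp_vec_def)
  moreover have "card (supp_vec g) > 0" using i by (auto simp: card_gt_0_iff)
  ultimately have N: "card (supp_vec g) \<le> Suc (n - 1)" "n \<ge> 1" by auto
  have "l1_norm_vec g \<le> (1 + real (n - 1) * circuit_imbalance n W) * \<bar>g $ i\<bar>"
    by (rule l1_norm_elementary_le[OF g i N(1)])
  also have "\<dots> \<le> (real n * circuit_imbalance n W) * \<bar>g $ i\<bar>"
    using circuit_imbalance_ge_1 N(2) by (intro mult_right_mono) (simp_all add: of_nat_diff algebra_simps)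
  finally show ?thesis .
qed

lemma l1_norm_elementary_pos:
  assumes g: "g \<in> elementary_vectors W"
  shows "l1_norm_vec g > 0"
proof -
  obtain i where "i < dim_vec g" "g $ i \<noteq> 0"
    using elementaryD(3)[OF g] by (auto simp: supp_vec_def)
  then show ?thesis unfolding l1_norm_vec_def by (intro sum_pos2[of _ i]) auto
qed

text \<open>The absolute value of the objective is invariant under nonzero scaling, so the objective
  takes finitely many values and attains its maximum.\<close>

lemma ex_steepest:
  assumes P: "\<And>g. P g \<Longrightarrow> g \<in> elementary_vectors W" and g: "P g"
  shows "\<exists>g. is_arg_max (\<lambda>h. - (c \<bullet> h) / l1_norm_vec h) P g"
proof -
  let ?f = "\<lambda>h. - (c \<bullet> h) / l1_norm_vec h"
  have "finite ((\<lambda>h. \<bar>?f h\<bar>) ` elementary_vectors W)"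
  proof (rule finite_image_elementary)
    fix h a assume h: "h \<in> elementary_vectors W" and a: "a \<noteq> (0 :: real)"
    note dim = elementaryD(2)[OF h]
    have "c \<bullet> (a \<cdot>\<^sub>v h) = a * (c \<bullet> h)"
      using dim by (simp add: scalar_prod_sum[of _ n] sum_distrib_left mult.left_commute)
    moreover have "l1_norm_vec (a \<cdot>\<^sub>v h) = \<bar>a\<bar> * l1_norm_vec h"
      using dim by (simp add: l1_norm_vec_def sum_distrib_left abs_mult)
    ultimately show "\<bar>?f (a \<cdot>\<^sub>v h)\<bar> = \<bar>?f h\<bar>" using a by (simp add: abs_mult)
  qed
  then have "finite (abs -` ((\<lambda>h. \<bar>?f h\<bar>) ` elementary_vectors W))"
    (is "finite (_ -` ?V)")
  proof -
    have "abs -` ?V \<subseteq> ?V \<union> uminus ` ?V"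
    proof
      fix y :: real assume "y \<in> abs -` ?V"
      then have y: "\<bar>y\<bar> \<in> ?V" by simp
      show "y \<in> ?V \<union> uminus ` ?V"
      proof (cases "y \<ge> 0")
        case False
        then have "y = - \<bar>y\<bar>" by simp
        with y show ?thesis by (intro UnI2 image_eqI[of _ _ "\<bar>y\<bar>"])
      qed (use y in simp)
    qed
    then show "finite (abs -` ?V)"
      using \<open>finite ?V\<close> by (meson finite_Un finite_imageI finite_subset)
  qed
  moreover have "?f ` Collect P \<subseteq> abs -` ((\<lambda>h. \<bar>?f h\<bar>) ` elementary_vectors W)"
    using P by auto
  ultimately have fin: "finite (?f ` Collect P)" by (rule rev_finite_subset)
  have "Max (?f ` Collect P) \<in> ?f ` Collect P" using fin g by (intro Max_in) auto
  then obtain h where h: "P h" "Max (?f ` Collect P) = ?f h" by auto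
  have "?f k \<le> ?f h" if "P k" for k
    using fin that unfolding h(2)[symmetric] by (intro Max_ge) auto
  then show ?thesis using h(1) unfolding is_arg_max_def by (meson not_less)
qed

end

section \<open>Directions, certificates and single augmentations\<close>

locale bounded_lp =
  fixes m n :: nat and A :: "real mat" and b c u :: "real vec"
  assumes A: "A \<in> carrier_mat m n" and u: "u \<in> carrier_vec n"
begin

sublocale real_vec_subspace n "mat_kernel A"
  by (rule real_vec_subspace_kernel[OF A])

abbreviation "feasible x \<equiv> lp_feasible A b u x"

lemma feasible_iff:
  "feasible x \<longleftrightarrow> x \<in> carrier_vec n \<and> A *\<^sub>v x = b \<and> (\<forall>i<n. 0 \<le> x $ i \<and> x $ i \<le> u $ i)"
proof -
  have dims: "dim_col A = n" "dim_vec u = n" using A u by auto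
  show ?thesis
  proof (cases "x \<in> carrier_vec n")
    case True
    then have "dim_vec x = n" by simp
    then show ?thesis using True by (simp add: lp_feasible_def less_eq_vec_def dims) blast
  qed (simp add: lp_feasible_def dims)
qed

lemma feasible_dim: "feasible x \<Longrightarrow> dim_vec x = n"
  by (auto simp: feasible_iff)

lemma feasible_diff:
  assumes "feasible x" "feasible y"
  shows "y - x \<in> mat_kernel A"
proof (rule mat_kernelI[OF A])
  have "x \<in> carrier_vec n" "y \<in> carrier_vec n" "A *\<^sub>v x = b" "A *\<^sub>v y = b"
    using assms by (simp_all add: feasible_iff)
  moreover have "b \<in> carrier_vec m" using mult_mat_vec_carrier[OF A] calculation by metis
  ultimately show "A *\<^sub>v (y - x) = 0\<^sub>v m" "y - x \<in> carrier_vec n"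
    by (simp_all add: mult_minus_distrib_mat_vec[OF A])
qed

section \<open>Allowed directions and approximately optimal reduced costs\<close>

definition allowed :: "real vec \<Rightarrow> real vec \<Rightarrow> bool" where
  "allowed x h \<longleftrightarrow> (\<forall>i<n. (x $ i = 0 \<longrightarrow> h $ i \<ge> 0) \<and> (x $ i = u $ i \<longrightarrow> h $ i \<le> 0))"

lemma augmenting_direction_iff:
  "augmenting_direction A c u x g \<longleftrightarrow>
     g \<in> elementary_vectors (mat_kernel A) \<and> c \<bullet> g < 0 \<and> allowed x g"
  unfolding augmenting_direction_def allowed_def using elementaryD(2) by metis

lemma conformal_diff_allowed:
  assumes "feasible x" "feasible y" "conformal h (y - x)" "dim_vec h = n"
  shows "allowed x h"
  unfolding allowed_def
proof (intro allI impI conjI)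
  fix i assume i: "i < n"
  have xy: "0 \<le> x $ i" "x $ i \<le> u $ i" "0 \<le> y $ i" "y $ i \<le> u $ i"
    using assms(1,2) i by (auto simp: feasible_iff)
  have h: "h $ i = 0 \<or> 0 < h $ i * (y $ i - x $ i)"
    using assms(3,4) i feasible_dim[OF assms(1)] feasible_dim[OF assms(2)]
    by (auto simp: conformal_def)
  show "h $ i \<ge> 0" if "x $ i = 0" using h xy that by (auto simp: zero_less_mult_iff)
  show "h $ i \<le> 0" if "x $ i = u $ i" using h xy that by (auto simp: zero_less_mult_iff)
qed

text \<open>Free of division, and ranging over all allowed circuits: for nonnegative
  \<open>e\<close> those of nonnegative cost satisfy the bound trivially, so it restricts only
  augmenting directions.\<close>

definition steepness_bound :: "real vec \<Rightarrow> real \<Rightarrow> bool" where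
  "steepness_bound x e \<longleftrightarrow>
     (\<forall>h\<in>elementary_vectors (mat_kernel A). allowed x h \<longrightarrow> - (c \<bullet> h) \<le> e * l1_norm_vec h)"

text \<open>\<open>s\<close> plays the role of the reduced costs \<open>c - A\<^sup>T y\<close> of a dual solution \<open>y\<close>, which are
  required to be \<open>e\<close>-optimal for \<open>x\<close> as in the cost-scaling analysis of min-cost flow.\<close>

definition dual_certificate :: "real vec \<Rightarrow> real \<Rightarrow> (nat \<Rightarrow> real) \<Rightarrow> bool" where
  "dual_certificate x e s \<longleftrightarrow>
     (\<forall>i<n. (x $ i < u $ i \<longrightarrow> - e \<le> s i) \<and> (0 < x $ i \<longrightarrow> s i \<le> e)) \<and>
     (\<forall>w\<in>mat_kernel A. c \<bullet> w = (\<Sum>i<n. s i * w $ i))"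

text \<open>An allowed \<open>h\<close> increases only coordinates below their upper bound, where
  \<open>s i\<close> is at least \<open>- e\<close>, and decreases only positive ones, where
  \<open>s i\<close> is at most \<open>e\<close>.\<close>

lemma dual_certificate_coord:
  assumes "dual_certificate x e s" "feasible x" "allowed x h" "i < n"
  shows "- (s i * h $ i) \<le> e * \<bar>h $ i\<bar>"
proof -
  have x: "0 \<le> x $ i" "x $ i \<le> u $ i" using assms(2,4) by (auto simp: feasible_iff)
  consider "h $ i = 0" | "h $ i > 0" | "h $ i < 0" by linarith
  then show ?thesis
  proof cases
    case 2
    then have "x $ i < u $ i" using assms(3,4) x by (auto simp: allowed_def order_less_le)
    then have "- e \<le> s i" using assms(1,4) by (auto simp: dual_certificate_def)
    then have "- e * h $ i \<le> s i * h $ i" using 2 by (intro mult_right_mono) auto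
    then show ?thesis using 2 by simp
  next
    case 3
    then have "0 < x $ i" using assms(3,4) x by (auto simp: allowed_def order_less_le)
    then have "s i \<le> e" using assms(1,4) by (auto simp: dual_certificate_def)
    then have "s i * (- h $ i) \<le> e * (- h $ i)" using 3 by (intro mult_right_mono) auto
    then show ?thesis using 3 by simp
  qed simp
qed

lemma l1_norm_sum: "dim_vec h = n \<Longrightarrow> l1_norm_vec h = (\<Sum>i<n. \<bar>h $ i\<bar>)"
  by (simp add: l1_norm_vec_def)

lemma dual_certificate_le:
  assumes s: "dual_certificate x e s" and x: "feasible x"
    and h: "h \<in> mat_kernel A" "allowed x h"
  shows "- (c \<bullet> h) \<le> e * l1_norm_vec h"
proof -
  have "- (c \<bullet> h) = (\<Sum>i<n. - (s i * h $ i))"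
    using s h(1) by (simp add: dual_certificate_def sum_negf)
  also have "\<dots> \<le> (\<Sum>i<n. e * \<bar>h $ i\<bar>)"
    by (intro sum_mono dual_certificate_coord[OF s x h(2)]) simp
  finally show ?thesis by (simp add: l1_norm_sum dim_mem[OF h(1)] sum_distrib_left)
qed

text \<open>A coordinate that brings no gain under \<open>s\<close> gives up its share of the norm.
  This is the source of the geometric decrease of the steepness.\<close>

lemma dual_certificate_le_opposed:
  assumes s: "dual_certificate x e s" and x: "feasible x"
    and h: "h \<in> mat_kernel A" "allowed x h" and j: "j < n" "s j * h $ j \<ge> 0"
  shows "- (c \<bullet> h) \<le> e * (l1_norm_vec h - \<bar>h $ j\<bar>)"
proof -
  have "- (c \<bullet> h) = - (s j * h $ j) + (\<Sum>i\<in>{..<n} - {j}. - (s i * h $ i))"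
    using s h(1) j(1) by (simp add: dual_certificate_def sum_negf sum.remove[of "{..<n}" j])
  also have "\<dots> \<le> (\<Sum>i\<in>{..<n} - {j}. - (s i * h $ i))" using j(2) by simp
  also have "\<dots> \<le> (\<Sum>i\<in>{..<n} - {j}. e * \<bar>h $ i\<bar>)"
    by (intro sum_mono dual_certificate_coord[OF s x h(2)]) simp
  also have "\<dots> = e * (l1_norm_vec h - \<bar>h $ j\<bar>)"
    using j(1) by (simp add: l1_norm_sum dim_mem[OF h(1)] sum_distrib_left sum.remove[of "{..<n}" j])
  finally show ?thesis .
qed

lemma dual_certificate_steepness:
  "dual_certificate x e s \<Longrightarrow> feasible x \<Longrightarrow> steepness_bound x e"
  unfolding steepness_bound_def using dual_certificate_le elementaryD(1) by blast

text \<open>Coordinates at a bound get the finite penalty \<open>M\<close> instead of an infinite one; \<open>M\<close> is chosen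
  such that the penalty outweighs the gain of every elementary vector that is not allowed.\<close>

lemma ex_dual_certificate:
  assumes x: "feasible x" and e: "0 \<le> e" and sb: "steepness_bound x e"
  shows "\<exists>s. dual_certificate x e s"
proof -
  let ?k = "circuit_imbalance n (mat_kernel A)"
  define B where "B = (\<Sum>i<n. \<bar>c $ i\<bar>)"
  define M where "M = real n * ?k * B"
  define a where "a i = (if x $ i < u $ i then e else M)" for i
  define a' where "a' i = (if 0 < x $ i then e else M)" for i
  have B: "B \<ge> 0" unfolding B_def by (intro sum_nonneg) auto
  then have M: "M \<ge> 0" using circuit_imbalance_ge_1 by (simp add: M_def)
  have nonneg: "0 \<le> a i" "0 \<le> a' i" for i using e M by (auto simp: a_def a'_def)
  let ?p = "\<lambda>h i. box_support (a i) (a' i) (h $ i)"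
  have elem: "(\<Sum>i<n. - c $ i * h $ i) \<le> (\<Sum>i<n. ?p h i)"
    if h: "h \<in> elementary_vectors (mat_kernel A)" for h
  proof (cases "allowed x h")
    case True
    have "(\<Sum>i<n. - c $ i * h $ i) = - (c \<bullet> h)"
      using elementaryD(2)[OF h] by (simp add: scalar_prod_sum sum_negf)
    also have "\<dots> \<le> e * l1_norm_vec h" using sb h True by (simp add: steepness_bound_def)
    also have "\<dots> = (\<Sum>i<n. e * \<bar>h $ i\<bar>)"
      using elementaryD(2)[OF h] by (simp add: l1_norm_sum sum_distrib_left)
    also have "\<dots> \<le> (\<Sum>i<n. ?p h i)"
    proof (rule sum_mono)
      fix i assume "i \<in> {..<n}"
      then have i: "i < n" by simp
      have xi: "0 \<le> x $ i" "x $ i \<le> u $ i" using x i by (auto simp: feasible_iff)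
      consider "h $ i = 0" | "h $ i > 0" | "h $ i < 0" by linarith
      then show "e * \<bar>h $ i\<bar> \<le> ?p h i"
      proof cases
        case 2
        then have "x $ i < u $ i" using True i xi by (auto simp: allowed_def order_less_le)
        then have "a i = e" by (simp add: a_def)
        then show ?thesis using 2 box_support_nonneg_arg[OF nonneg[of i], of "h $ i"] by simp
      next
        case 3
        then have "0 < x $ i" using True i xi by (auto simp: allowed_def order_less_le)
        then have "a' i = e" by (simp add: a'_def)
        then show ?thesis using 3 box_support_nonpos_arg[OF nonneg[of i], of "h $ i"] by simp
      qed (simp add: box_support_def)
    qed
    finally show ?thesis .
  next
    case False
    then obtain i where i: "i < n" "x $ i = 0 \<and> h $ i < 0 \<or> x $ i = u $ i \<and> h $ i > 0"
      by (fastforce simp: allowed_def)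
    have pi: "?p h i = M * \<bar>h $ i\<bar>"
      using i(2)
    proof
      assume h: "x $ i = 0 \<and> h $ i < 0"
      then have "a' i = M" by (simp add: a'_def)
      then show ?thesis using h box_support_nonpos_arg[OF nonneg[of i], of "h $ i"] by simp
    next
      assume h: "x $ i = u $ i \<and> h $ i > 0"
      then have "a i = M" by (simp add: a_def)
      then show ?thesis using h box_support_nonneg_arg[OF nonneg[of i], of "h $ i"] by simp
    qed
    have isupp: "i \<in> supp_vec h" using i elementaryD(2)[OF h] by (auto simp: supp_vec_def)
    have "(\<Sum>j<n. - c $ j * h $ j) \<le> (\<Sum>j<n. B * \<bar>h $ j\<bar>)"
    proof (rule sum_mono)
      fix j assume j: "j \<in> {..<n}"
      have "\<bar>c $ j\<bar> \<le> B" unfolding B_def using j by (intro member_le_sum) auto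
      then have "\<bar>c $ j\<bar> * \<bar>h $ j\<bar> \<le> B * \<bar>h $ j\<bar>" by (intro mult_right_mono) auto
      then show "- c $ j * h $ j \<le> B * \<bar>h $ j\<bar>"
        using abs_ge_self[of "- c $ j * h $ j"] by (simp add: abs_mult)
    qed
    also have "\<dots> = B * l1_norm_vec h"
      using elementaryD(2)[OF h] by (simp add: l1_norm_sum sum_distrib_left)
    \<comment> \<open>The imbalance bounds the whole norm by the violating entry, which explains the
      value of \<open>M\<close>.\<close>
    also have "\<dots> \<le> B * (real n * ?k * \<bar>h $ i\<bar>)"
      by (intro mult_left_mono l1_norm_elementary_le_dim h isupp B)
    also have "\<dots> = ?p h i" unfolding pi by (simp add: M_def)
    also have "\<dots> \<le> (\<Sum>j<n. ?p h j)"
      using i(1) nonneg by (intro member_le_sum) (auto intro: box_support_nonneg)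
    finally show ?thesis .
  qed
  have bound: "(\<Sum>i<n. - c $ i * w $ i) \<le> (\<Sum>i<n. ?p w i)" if "w \<in> mat_kernel A" for w
    by (rule conformal_bound[OF _ _ _ that]) (rule nonneg elem | assumption)+
  obtain s where s: "\<And>i. i < n \<Longrightarrow> - a' i \<le> s i \<and> s i \<le> a i"
    and sw: "\<And>w. w \<in> mat_kernel A \<Longrightarrow> (\<Sum>i<n. - c $ i * w $ i) = (\<Sum>i<n. s i * w $ i)"
  proof (rule box_dual[of a' a "\<lambda>i. - c $ i"])
    show "- a' i \<le> a i" for i using nonneg[of i] by linarith
  qed (use bound in auto)
  \<comment> \<open>The multipliers represent the negative of \<open>c\<close>, hence the change of
    sign.\<close>
  have "dual_certificate x e (\<lambda>i. - s i)"
    unfolding dual_certificate_def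
  proof (intro conjI allI impI ballI)
    fix i assume i: "i < n"
    show "- e \<le> - s i" if "x $ i < u $ i" using s[OF i] that by (simp add: a_def)
    show "- s i \<le> e" if "0 < x $ i" using s[OF i] that by (simp add: a'_def)
  next
    fix w assume w: "w \<in> mat_kernel A"
    show "c \<bullet> w = (\<Sum>i<n. - s i * w $ i)"
      using sw[OF w] by (simp add: scalar_prod_sum[OF dim_mem[OF w]] sum_negf)
  qed
  then show ?thesis by blast
qed

text \<open>Every circuit conformal to \<open>y - x\<close> is allowed at \<open>x\<close> and so
  has nonnegative cost. Applying \<open>conformal_bound\<close> with the box shrunk to the point 0
  extends this to \<open>y - x\<close>.\<close>

lemma no_augmenting_imp_optimal:
  assumes x: "feasible x" and none: "\<nexists>g. augmenting_direction A c u x g"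
  shows "lp_optimal A b c u x"
  unfolding lp_optimal_def
proof (intro conjI allI impI x)
  fix y assume y: "feasible y"
  note [simp] = feasible_dim[OF x] feasible_dim[OF y]
  have "(\<Sum>i<n. - c $ i * (y - x) $ i) \<le> (\<Sum>i<n. box_support 0 0 ((y - x) $ i))"
  proof (rule conformal_bound)
    fix h assume h: "h \<in> elementary_vectors (mat_kernel A)" "conformal h (y - x)"
    have "allowed x h" using conformal_diff_allowed[OF x y h(2)] elementaryD(2)[OF h(1)] .
    then have "c \<bullet> h \<ge> 0" using none h(1) by (auto simp: augmenting_direction_iff not_less)
    then show "(\<Sum>i<n. - c $ i * h $ i) \<le> (\<Sum>i<n. box_support 0 0 (h $ i))"
      using elementaryD(2)[OF h(1)] by (simp add: scalar_prod_sum sum_negf box_support_def)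
  qed (use feasible_diff[OF x y] in auto)
  then show "c \<bullet> x \<le> c \<bullet> y"
    by (simp add: box_support_def scalar_prod_sum[of _ n] right_diff_distrib sum_subtractf sum_negf)
qed

section \<open>Step lengths and maximal augmentations\<close>

definition step_limit :: "real vec \<Rightarrow> real vec \<Rightarrow> nat \<Rightarrow> real" where
  "step_limit x g i = (if g $ i > 0 then (u $ i - x $ i) / g $ i else x $ i / - g $ i)"

text \<open>Kernel directions preserve the equations, and for nonnegative \<open>t\<close> a
  coordinate can violate only the bound it moves towards, which it reaches at its
  \<open>step_limit\<close>.\<close>

lemma feasible_ray_iff:
  assumes x: "feasible x" and g: "g \<in> mat_kernel A" and t: "0 \<le> t"
  shows "feasible (x + t \<cdot>\<^sub>v g) \<longleftrightarrow> (\<forall>i\<in>supp_vec g. t \<le> step_limit x g i)"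
proof -
  have xg: "x \<in> carrier_vec n" "g \<in> carrier_vec n" "A *\<^sub>v g = 0\<^sub>v m" "A *\<^sub>v x = b"
    using x mat_kernelD[OF A g] by (auto simp: feasible_iff)
  then have "b \<in> carrier_vec m" using mult_mat_vec_carrier[OF A] by metis
  moreover have "t \<cdot>\<^sub>v 0\<^sub>v m = 0\<^sub>v m" by (intro eq_vecI) auto
  ultimately have "A *\<^sub>v (x + t \<cdot>\<^sub>v g) = b"
    using xg by (simp add: mult_add_distrib_mat_vec[OF A] mult_mat_vec[OF A])
  then have "feasible (x + t \<cdot>\<^sub>v g) \<longleftrightarrow>
      (\<forall>i<n. 0 \<le> x $ i + t * g $ i \<and> x $ i + t * g $ i \<le> u $ i)"
    using xg by (simp add: feasible_iff)
  also have "\<dots> \<longleftrightarrow> (\<forall>i<n. g $ i \<noteq> 0 \<longrightarrow> t \<le> step_limit x g i)"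
  proof (intro all_cong)
    fix i assume i: "i < n"
    have xi: "0 \<le> x $ i" "x $ i \<le> u $ i" using x i by (auto simp: feasible_iff)
    consider "g $ i = 0" | "g $ i > 0" | "g $ i < 0" by linarith
    then show "(0 \<le> x $ i + t * g $ i \<and> x $ i + t * g $ i \<le> u $ i) =
        (g $ i \<noteq> 0 \<longrightarrow> t \<le> step_limit x g i)"
    proof cases
      case 2
      then have "t * g $ i \<ge> 0" using t by simp
      then show ?thesis using 2 xi by (auto simp: step_limit_def field_simps)
    next
      case 3
      then have "t * g $ i \<le> 0" using t by (simp add: mult_nonneg_nonpos)
      then show ?thesis using 3 xi by (auto simp: step_limit_def field_simps)
    qed (use xi in simp)
  qed
  also have "\<dots> \<longleftrightarrow> (\<forall>i\<in>supp_vec g. t \<le> step_limit x g i)"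
    using xg by (auto simp: supp_vec_def)
  finally show ?thesis .
qed

lemma step_limit_pos:
  assumes "feasible x" "allowed x g" "i < n" "g $ i \<noteq> 0"
  shows "step_limit x g i > 0"
proof -
  have xi: "0 \<le> x $ i" "x $ i \<le> u $ i" using assms by (auto simp: feasible_iff)
  show ?thesis
  proof (cases "g $ i > 0")
    case True
    then have "x $ i \<noteq> u $ i" using assms by (force simp: allowed_def)
    then show ?thesis using True xi by (simp add: step_limit_def)
  next
    case False
    then have "g $ i < 0" "x $ i \<noteq> 0" using assms by (force simp: allowed_def)+
    then show ?thesis using xi by (simp add: step_limit_def divide_less_0_iff)
  qed
qed

text \<open>A ratio test: the longest feasible step is the least limit over the support, positive
  because \<open>g\<close> is allowed. Existence of the augmentation follows, and the minimising
  coordinate is the one that hits its bound.\<close>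

lemma maximal_augmentation_iff:
  assumes x: "feasible x" and g: "g \<in> elementary_vectors (mat_kernel A)" "allowed x g"
  shows "maximal_augmentation A b u x g y \<longleftrightarrow>
    y = x + Min (step_limit x g ` supp_vec g) \<cdot>\<^sub>v g"
proof -
  let ?\<mu> = "Min (step_limit x g ` supp_vec g)"
  have fin: "finite (step_limit x g ` supp_vec g)" "step_limit x g ` supp_vec g \<noteq> {}"
    using elementaryD(3)[OF g(1)] by auto
  have "step_limit x g i > 0" if "i \<in> supp_vec g" for i
    using that elementaryD(2)[OF g(1)] by (intro step_limit_pos x g) (auto simp: supp_vec_def)
  then have pos: "?\<mu> > 0" using fin by auto
  have feas: "feasible (x + t \<cdot>\<^sub>v g) \<longleftrightarrow> t \<le> ?\<mu>" if "t > 0" for t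
    using feasible_ray_iff[OF x elementaryD(1)[OF g(1)]] that fin by auto
  show ?thesis
  proof
    assume "maximal_augmentation A b u x g y"
    then obtain \<alpha> where \<alpha>: "\<alpha> > 0" "y = x + \<alpha> \<cdot>\<^sub>v g" "feasible y"
      and max: "\<And>\<beta>. \<beta> > 0 \<Longrightarrow> feasible (x + \<beta> \<cdot>\<^sub>v g) \<Longrightarrow> \<beta> \<le> \<alpha>"
      unfolding maximal_augmentation_def by blast
    have "\<alpha> \<le> ?\<mu>" using feas[OF \<alpha>(1)] \<alpha>(2,3) by blast
    moreover have "?\<mu> \<le> \<alpha>" using max[OF pos] feas[OF pos] by blast
    ultimately show "y = x + ?\<mu> \<cdot>\<^sub>v g" using \<alpha>(2) by simp
  next
    assume "y = x + ?\<mu> \<cdot>\<^sub>v g"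
    then show "maximal_augmentation A b u x g y"
      unfolding maximal_augmentation_def using pos feas by blast
  qed
qed

lemma maximal_augmentationD:
  assumes x: "feasible x" and g: "g \<in> elementary_vectors (mat_kernel A)" "allowed x g"
    and y: "maximal_augmentation A b u x g y"
  shows "feasible y"
    and "\<exists>\<alpha>>0. y = x + \<alpha> \<cdot>\<^sub>v g"
    and "\<exists>i<n. g $ i > 0 \<and> y $ i = u $ i \<or> g $ i < 0 \<and> y $ i = 0"
proof -
  show "feasible y" "\<exists>\<alpha>>0. y = x + \<alpha> \<cdot>\<^sub>v g"
    using y unfolding maximal_augmentation_def by blast+
  let ?\<mu> = "Min (step_limit x g ` supp_vec g)"
  have "?\<mu> \<in> step_limit x g ` supp_vec g"
    using elementaryD(3)[OF g(1)] by (intro Min_in) auto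
  then obtain i where i: "i \<in> supp_vec g" "?\<mu> = step_limit x g i" by blast
  have i': "i < n" "g $ i \<noteq> 0" using i(1) elementaryD(2)[OF g(1)] by (auto simp: supp_vec_def)
  have "y = x + step_limit x g i \<cdot>\<^sub>v g"
    using y maximal_augmentation_iff[OF x g] i(2) by simp
  then have "y $ i = x $ i + step_limit x g i * g $ i"
    using i' elementaryD(2)[OF g(1)] by simp
  then have "g $ i > 0 \<and> y $ i = u $ i \<or> g $ i < 0 \<and> y $ i = 0"
    using i'(2) by (auto simp: step_limit_def linorder_neq_iff)
  then show "\<exists>i<n. g $ i > 0 \<and> y $ i = u $ i \<or> g $ i < 0 \<and> y $ i = 0"
    using i'(1) by blast
qed

lemma ex_steepest_descent_step:
  assumes x: "feasible x" and g: "augmenting_direction A c u x g"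
  shows "\<exists>y. steepest_descent_step A b c u x y"
proof -
  obtain h where h: "is_arg_max (\<lambda>h. - (c \<bullet> h) / l1_norm_vec h) (augmenting_direction A c u x) h"
    using ex_steepest[of "augmenting_direction A c u x" g c] g
    by (auto simp: augmenting_direction_iff)
  then have "augmenting_direction A c u x h" by (simp add: is_arg_max_def)
  then have "maximal_augmentation A b u x h (x + Min (step_limit x h ` supp_vec h) \<cdot>\<^sub>v h)"
    using maximal_augmentation_iff[OF x] by (simp add: augmenting_direction_iff)
  with h show ?thesis unfolding steepest_descent_step_def by blast
qed

lemma steepest_descent_stepE:
  assumes x: "feasible x" and step: "steepest_descent_step A b c u x y"
  obtains g \<alpha> where "g \<in> elementary_vectors (mat_kernel A)" "allowed x g" "c \<bullet> g < 0"
    "steepness_bound x (- (c \<bullet> g) / l1_norm_vec g)" "\<alpha> > 0" "y = x + \<alpha> \<cdot>\<^sub>v g" "feasible y"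
    "\<exists>i<n. g $ i > 0 \<and> y $ i = u $ i \<or> g $ i < 0 \<and> y $ i = 0"
proof -
  obtain g where max: "is_arg_max (\<lambda>h. - (c \<bullet> h) / l1_norm_vec h) (augmenting_direction A c u x) g"
    and y: "maximal_augmentation A b u x g y"
    using step unfolding steepest_descent_step_def by blast
  have g: "g \<in> elementary_vectors (mat_kernel A)" "allowed x g" "c \<bullet> g < 0"
    using max by (auto simp: is_arg_max_def augmenting_direction_iff)
  let ?e = "- (c \<bullet> g) / l1_norm_vec g"
  have e: "?e > 0" using g(3) l1_norm_elementary_pos[OF g(1)] by (simp add: divide_less_0_iff)
  have "steepness_bound x ?e"
    unfolding steepness_bound_def
  proof (intro ballI impI)
    fix h assume h: "h \<in> elementary_vectors (mat_kernel A)" "allowed x h"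
    have pos: "l1_norm_vec h > 0" by (rule l1_norm_elementary_pos[OF h(1)])
    \<comment> \<open>Maximality compares augmenting directions only; the other allowed circuits
      satisfy the bound by sign.\<close>
    show "- (c \<bullet> h) \<le> ?e * l1_norm_vec h"
    proof (cases "c \<bullet> h < 0")
      case True
      then have "- (c \<bullet> h) / l1_norm_vec h \<le> ?e"
        using max h unfolding is_arg_max_def augmenting_direction_iff by (meson not_less)
      then show ?thesis using pos by (simp only: pos_divide_le_eq)
    next
      case False
      moreover have "?e * l1_norm_vec h \<ge> 0" using e pos by (intro mult_nonneg_nonneg) auto
      ultimately show ?thesis by linarith
    qed
  qed
  with maximal_augmentationD[OF x g(1,2) y] g show thesis using that by blast
qed

end

section \<open>Counting augmentations\<close>

locale steepest_descent_iterates = bounded_lp +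
  fixes x :: "nat \<Rightarrow> real vec" and T :: nat and g :: "nat \<Rightarrow> real vec"
  assumes n_pos: "1 \<le> n"
    and feasible_start: "feasible (x 0)"
    and direction: "t < T \<Longrightarrow> g t \<in> elementary_vectors (mat_kernel A)"
      "t < T \<Longrightarrow> allowed (x t) (g t)"
      "t < T \<Longrightarrow> c \<bullet> g t < 0"
      "t < T \<Longrightarrow> steepness_bound (x t) (- (c \<bullet> g t) / l1_norm_vec (g t))"
    and augment: "t < T \<Longrightarrow> \<exists>\<alpha>>0. x (Suc t) = x t + \<alpha> \<cdot>\<^sub>v g t"
      "t < T \<Longrightarrow> feasible (x (Suc t))"
      "t < T \<Longrightarrow> \<exists>i<n. g t $ i > 0 \<and> x (Suc t) $ i = u $ i \<or> g t $ i < 0 \<and> x (Suc t) $ i = 0"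
begin

section \<open>Monotonicity of the steepness\<close>

abbreviation "\<kappa> \<equiv> circuit_imbalance n (mat_kernel A)"

definition steepness :: "nat \<Rightarrow> real" where
  "steepness t = - (c \<bullet> g t) / l1_norm_vec (g t)"

lemma feasible_iterate: "t \<le> T \<Longrightarrow> feasible (x t)"
  using feasible_start augment(2) by (cases t) auto

lemma g_dim: "t < T \<Longrightarrow> dim_vec (g t) = n"
  using direction(1) elementaryD(2) by blast

lemma l1_norm_g_pos: "t < T \<Longrightarrow> l1_norm_vec (g t) > 0"
  using direction(1) l1_norm_elementary_pos by blast

lemma steepness_pos: "t < T \<Longrightarrow> steepness t > 0"
  using direction(3) l1_norm_g_pos by (simp add: steepness_def divide_less_0_iff)

lemma steepness_eq: "t < T \<Longrightarrow> - (c \<bullet> g t) = steepness t * l1_norm_vec (g t)"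
  using l1_norm_g_pos[of t] by (simp add: steepness_def)

lemma iterate_coord:
  assumes "t < T"
  obtains \<alpha> where "\<alpha> > 0" "\<And>i. i < n \<Longrightarrow> x (Suc t) $ i = x t $ i + \<alpha> * g t $ i"
proof -
  obtain \<alpha> where \<alpha>: "\<alpha> > 0" "x (Suc t) = x t + \<alpha> \<cdot>\<^sub>v g t" using augment(1)[OF assms] by blast
  have "x (Suc t) $ i = x t $ i + \<alpha> * g t $ i" if "i < n" for i
    using \<alpha>(2) that g_dim[OF assms] by simp
  with \<alpha>(1) show thesis by (rule that)
qed

text \<open>If a used coordinate brought no gain, \<open>dual_certificate_le_opposed\<close> would
  bound the gain of \<open>g t\<close> strictly below the value it attains.\<close>

lemma certificate_tight:
  assumes t: "t < T" and s: "dual_certificate (x t) (steepness t) s"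
    and i: "i < n" "g t $ i \<noteq> 0"
  shows "s i * g t $ i < 0"
proof (rule ccontr)
  assume "\<not> s i * g t $ i < 0"
  then have "s i * g t $ i \<ge> 0" by simp
  then have "steepness t * l1_norm_vec (g t) \<le> steepness t * (l1_norm_vec (g t) - \<bar>g t $ i\<bar>)"
    using dual_certificate_le_opposed[OF s feasible_iterate elementaryD(1)[OF direction(1)] direction(2)]
      t i(1) steepness_eq[OF t] by simp
  moreover have "steepness t * \<bar>g t $ i\<bar> > 0" using steepness_pos[OF t] i(2) by simp
  ultimately show False by (simp add: right_diff_distrib)
qed

text \<open>A new constraint on \<open>s i\<close> appears only when coordinate \<open>i\<close>
  leaves a bound; the direction of that move then fixes the sign of \<open>s i\<close>, which
  already implies the constraint.\<close>

lemma certificate_preserved: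
  assumes t: "t < T" and s: "dual_certificate (x t) e s" and e: "0 \<le> e"
    and tight: "\<And>i. i < n \<Longrightarrow> g t $ i \<noteq> 0 \<Longrightarrow> s i * g t $ i < 0"
  shows "dual_certificate (x (Suc t)) e s"
proof -
  obtain \<alpha> where \<alpha>: "\<alpha> > 0" "\<And>i. i < n \<Longrightarrow> x (Suc t) $ i = x t $ i + \<alpha> * g t $ i"
    using iterate_coord[OF t] by blast
  have "- e \<le> s i" if i: "i < n" and lt: "x (Suc t) $ i < u $ i" for i
  proof (cases "x t $ i < u $ i")
    case False
    then have "\<alpha> * g t $ i < 0" using lt \<alpha>(2)[OF i] by simp
    then have "g t $ i < 0" using \<alpha>(1) by (simp add: mult_less_0_iff)
    then have "s i > 0" using tight[OF i] by (simp add: mult_less_0_iff)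
    then show ?thesis using e by simp
  qed (use s i in \<open>simp add: dual_certificate_def\<close>)
  moreover have "s i \<le> e" if i: "i < n" and gt: "0 < x (Suc t) $ i" for i
  proof (cases "0 < x t $ i")
    case False
    then have "\<alpha> * g t $ i > 0" using gt \<alpha>(2)[OF i] by simp
    then have "g t $ i > 0" using \<alpha>(1) by (simp add: zero_less_mult_iff)
    then have "s i < 0" using tight[OF i] by (simp add: mult_less_0_iff)
    then show ?thesis using e by simp
  qed (use s i in \<open>simp add: dual_certificate_def\<close>)
  ultimately show ?thesis using s by (simp add: dual_certificate_def)
qed

lemma ex_certificate:
  assumes "t < T"
  obtains s where "dual_certificate (x t) (steepness t) s"
proof -
  have "steepness_bound (x t) (steepness t)"
    using direction(4)[OF assms] by (simp add: steepness_def)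
  then show thesis
    using ex_dual_certificate[OF feasible_iterate] steepness_pos[OF assms] assms that
    by (meson less_imp_le)
qed

lemma steepness_le_bound:
  assumes "t < T" "steepness_bound (x t) e"
  shows "steepness t \<le> e"
proof -
  have "- (c \<bullet> g t) \<le> e * l1_norm_vec (g t)"
    using assms direction(1,2) by (simp add: steepness_bound_def)
  then show ?thesis
    using l1_norm_g_pos[OF assms(1)] by (simp add: steepness_eq[OF assms(1)])
qed

lemma steepness_bound_mono:
  assumes "steepness_bound y e" "e \<le> e'"
  shows "steepness_bound y e'"
  unfolding steepness_bound_def
proof (intro ballI impI)
  fix h assume h: "h \<in> elementary_vectors (mat_kernel A)" "allowed y h"
  have "e * l1_norm_vec h \<le> e' * l1_norm_vec h"
    using assms(2) l1_norm_elementary_pos[OF h(1)] by (intro mult_right_mono) auto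
  then show "- (c \<bullet> h) \<le> e' * l1_norm_vec h"
    using assms(1) h by (force simp: steepness_bound_def)
qed

text \<open>A certificate for the current steepness is tight on the chosen direction, hence survives
  the step and bounds the steepness at the next iterate.\<close>

lemma steepness_bound_later:
  assumes "t < T" "t \<le> t'" "t' \<le> T"
  shows "steepness_bound (x t') (steepness t)"
  using assms(2,3)
proof (induction t' rule: dec_induct)
  case base
  show ?case using direction(4)[OF assms(1)] by (simp add: steepness_def)
next
  case (step k)
  then have k: "k < T" "steepness_bound (x k) (steepness t)" by auto
  obtain s where s: "dual_certificate (x k) (steepness k) s" by (rule ex_certificate[OF k(1)])
  have "dual_certificate (x (Suc k)) (steepness k) s"
    using certificate_preserved[OF k(1) s] certificate_tight[OF k(1) s] steepness_pos[OF k(1)]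
    by simp
  then have "steepness_bound (x (Suc k)) (steepness k)"
    using dual_certificate_steepness augment(2)[OF k(1)] by blast
  then show ?case
    using steepness_bound_mono steepness_le_bound[OF k] by blast
qed

lemma steepness_antimono: "t \<le> t' \<Longrightarrow> t' < T \<Longrightarrow> steepness t' \<le> steepness t"
  using steepness_le_bound steepness_bound_later by simp

text \<open>Otherwise each of \<open>n + 1\<close> steps would bring a new coordinate to the bound
  that \<open>s\<close> favours while losing none. Here \<open>s\<close> is an arbitrary sign
  pattern.\<close>

lemma opposed_step:
  assumes T: "t + n < T"
  shows "\<exists>l i. t \<le> l \<and> l \<le> t + n \<and> i < n \<and> g l $ i \<noteq> 0 \<and> s i * g l $ i \<ge> 0"
proof (rule ccontr)
  assume none: "\<not> ?thesis"
  have tight: "s i * g l $ i < 0" if "t \<le> l" "l \<le> t + n" "i < n" "g l $ i \<noteq> 0" for l i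
    using none that by (meson not_less)
  \<comment> \<open>These coordinates sit at the bound that minimises \<open>s i\<close> times the
    coordinate; indices with \<open>s i = 0\<close> are left out.\<close>
  define N where "N l = {i. i < n \<and> (s i < 0 \<and> x l $ i = u $ i \<or> s i > 0 \<and> x l $ i = 0)}" for l
  have fin: "finite (N l)" for l by (simp add: N_def)
  have grow: "N l \<subset> N (Suc l)" if l: "t \<le> l" "l \<le> t + n" for l
  proof -
    have lT: "l < T" using l T by simp
    obtain \<alpha> where \<alpha>: "\<alpha> > 0" "\<And>i. i < n \<Longrightarrow> x (Suc l) $ i = x l $ i + \<alpha> * g l $ i"
      using iterate_coord[OF lT] by blast
    have al: "(x l $ i = 0 \<longrightarrow> g l $ i \<ge> 0) \<and> (x l $ i = u $ i \<longrightarrow> g l $ i \<le> 0)" if "i < n" for i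
      using direction(2)[OF lT] that by (simp add: allowed_def)
    have "i \<in> N (Suc l)" if i: "i \<in> N l" for i
    proof -
      have i': "i < n" "s i < 0 \<and> x l $ i = u $ i \<or> s i > 0 \<and> x l $ i = 0"
        using i by (auto simp: N_def)
      then have "s i * g l $ i \<ge> 0"
        using al[OF i'(1)] by (auto simp: zero_le_mult_iff)
      then have "g l $ i = 0" using tight[OF l i'(1)] by linarith
      then show ?thesis using i' \<alpha>(2)[OF i'(1)] by (simp add: N_def)
    qed
    moreover obtain i where i: "i < n"
      "g l $ i > 0 \<and> x (Suc l) $ i = u $ i \<or> g l $ i < 0 \<and> x (Suc l) $ i = 0"
      using augment(3)[OF lT] by blast
    have si: "s i * g l $ i < 0" using tight[OF l i(1)] i(2) by auto
    have "i \<in> N (Suc l)" "i \<notin> N l"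
      using i si al[OF i(1)] by (auto simp: N_def mult_less_0_iff)
    ultimately show ?thesis by blast
  qed
  have "j \<le> card (N (t + j))" if "j \<le> Suc n" for j
    using that
  proof (induction j)
    case (Suc j)
    then have "card (N (t + j)) < card (N (Suc (t + j)))"
      by (intro psubset_card_mono grow fin) auto
    then show ?case using Suc by simp
  qed simp
  from this[of "Suc n"] have "Suc n \<le> card (N (t + Suc n))" by simp
  also have "\<dots> \<le> card {..<n}" by (intro card_mono) (auto simp: N_def)
  finally show False by simp
qed

text \<open>The share of the l1 norm guaranteed to every nonzero entry of a circuit with at most
  \<open>m + 1\<close> such entries.\<close>

definition contraction :: real where
  "contraction = 1 / (1 + real m * \<kappa>)"

lemma contraction_bounds: "0 < contraction" "contraction \<le> 1"
  using circuit_imbalance_ge_1 by (auto simp: contraction_def add_pos_nonneg divide_le_eq)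

lemma steepness_contracts:
  assumes T: "t + n < T"
  shows "steepness (t + n) \<le> (1 - contraction) * steepness t"
proof -
  have t: "t < T" using T by simp
  obtain s where s: "dual_certificate (x t) (steepness t) s" by (rule ex_certificate[OF t])
  define opposed where "opposed l \<longleftrightarrow> t \<le> l \<and> (\<exists>i<n. g l $ i \<noteq> 0 \<and> s i * g l $ i \<ge> 0)" for l
  \<comment> \<open>The first opposed step is taken because the certificate of step \<open>t\<close>
    survives all steps before it.\<close>
  define l where "l = (LEAST l. opposed l)"
  obtain l' where l': "opposed l'" "l' \<le> t + n"
    using opposed_step[OF T, of s] by (auto simp: opposed_def)
  have l: "opposed l" "l \<le> t + n"
    using LeastI[of opposed, OF l'(1)] Least_le[of opposed, OF l'(1)] l'(2) by (auto simp: l_def)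
  have tl: "t \<le> l" and lT: "l < T" using l T by (auto simp: opposed_def)
  have "dual_certificate (x k) (steepness t) s" if "t \<le> k" "k \<le> l" for k
    using that
  proof (induction k rule: dec_induct)
    case (step k)
    have "\<not> opposed k" using not_less_Least[of k opposed] step.prems by (simp add: l_def)
    then have "s i * g k $ i < 0" if "i < n" "g k $ i \<noteq> 0" for i
      using step.hyps(1) that by (auto simp: opposed_def not_le)
    moreover have "k < T" using step.prems lT by simp
    ultimately show ?case
      using certificate_preserved[of k "steepness t" s] step steepness_pos[OF t] by simp
  qed (rule s)
  then have cert: "dual_certificate (x l) (steepness t) s" using tl by simp
  obtain i where i: "i < n" "g l $ i \<noteq> 0" "s i * g l $ i \<ge> 0" using l(1) by (auto simp: opposed_def)
  note gl = direction(1)[OF lT]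
  have "l1_norm_vec (g l) \<le> (1 + real m * \<kappa>) * \<bar>g l $ i\<bar>"
    using i g_dim[OF lT]
    by (intro l1_norm_elementary_le gl card_supp_elementary_kernel[OF A]) (auto simp: supp_vec_def)
  moreover have "1 + real m * \<kappa> > 0" using circuit_imbalance_ge_1 by (simp add: add_pos_nonneg)
  ultimately have gi: "contraction * l1_norm_vec (g l) \<le> \<bar>g l $ i\<bar>"
    by (simp add: contraction_def pos_divide_le_eq mult.commute)
  have "steepness l * l1_norm_vec (g l) \<le> steepness t * (l1_norm_vec (g l) - \<bar>g l $ i\<bar>)"
    using dual_certificate_le_opposed[OF cert feasible_iterate elementaryD(1)[OF gl] direction(2)[OF lT] i(1,3)]
      lT by (simp add: steepness_eq)
  also have "\<dots> \<le> steepness t * ((1 - contraction) * l1_norm_vec (g l))"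
    using gi steepness_pos[OF t] by (intro mult_left_mono) (auto simp: algebra_simps)
  also have "\<dots> = ((1 - contraction) * steepness t) * l1_norm_vec (g l)" by (simp only: mult_ac)
  finally have "steepness l \<le> (1 - contraction) * steepness t"
    using l1_norm_g_pos[OF lT] by (rule mult_right_le_imp_le)
  moreover have "steepness (t + n) \<le> steepness l" using l T by (intro steepness_antimono) auto
  ultimately show ?thesis by simp
qed

lemma steepness_contracts_power:
  assumes "t + k * n < T"
  shows "steepness (t + k * n) \<le> (1 - contraction) ^ k * steepness t"
  using assms
proof (induction k)
  case (Suc k)
  have "steepness (t + Suc k * n) = steepness (t + k * n + n)" by (simp add: algebra_simps)
  also have "\<dots> \<le> (1 - contraction) * steepness (t + k * n)"
    using Suc.prems by (intro steepness_contracts) (simp add: algebra_simps)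
  also have "\<dots> \<le> (1 - contraction) * ((1 - contraction) ^ k * steepness t)"
    using Suc contraction_bounds by (intro mult_left_mono) auto
  finally show ?case by simp
qed simp

text \<open>Once the steepness has dropped by a factor above \<open>2 n \<kappa>\<close>, some coordinate moved by the old
  step has a reduced cost that is too large for any later iterate to move it again.\<close>

lemma coordinate_frozen:
  assumes t: "t \<le> t'" "t' < T" and drop: "2 * real n * \<kappa> * steepness t' < steepness t"
  shows "\<exists>i<n. g t $ i \<noteq> 0 \<and> (\<forall>k. t' \<le> k \<and> k \<le> T \<longrightarrow> x k $ i = x t' $ i)"
proof -
  have tT: "t < T" using t by simp
  obtain s where s: "dual_certificate (x t') (steepness t') s" by (rule ex_certificate[OF t(2)])
  have x': "feasible (x t')" using feasible_iterate t(2) by simp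
  \<comment> \<open>Averaging: the terms \<open>- (s i * g t $ i)\<close> add up to the steepness
    times the l1 norm, so some coordinate carries at least its share.\<close>
  have "\<exists>i<n. g t $ i \<noteq> 0 \<and> steepness t * \<bar>g t $ i\<bar> \<le> - (s i * g t $ i)"
  proof (rule ccontr)
    assume "\<not> ?thesis"
    then have less: "- (s i * g t $ i) < steepness t * \<bar>g t $ i\<bar>" if "i < n" "g t $ i \<noteq> 0" for i
      using that by (meson not_less)
    obtain j where "j \<in> supp_vec (g t)" using elementaryD(3)[OF direction(1)[OF tT]] by blast
    then have j: "j < n" "g t $ j \<noteq> 0" using g_dim[OF tT] by (auto simp: supp_vec_def)
    have "- (c \<bullet> g t) = (\<Sum>i<n. - (s i * g t $ i))"
      using s elementaryD(1)[OF direction(1)[OF tT]] by (simp add: dual_certificate_def sum_negf)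
    also have "\<dots> < (\<Sum>i<n. steepness t * \<bar>g t $ i\<bar>)"
    proof (rule sum_strict_mono_ex1)
      show "\<forall>i\<in>{..<n}. - (s i * g t $ i) \<le> steepness t * \<bar>g t $ i\<bar>"
      proof
        fix i assume "i \<in> {..<n}"
        then show "- (s i * g t $ i) \<le> steepness t * \<bar>g t $ i\<bar>"
          using less[of i] by (cases "g t $ i = 0") auto
      qed
      show "\<exists>i\<in>{..<n}. - (s i * g t $ i) < steepness t * \<bar>g t $ i\<bar>" using less j by blast
    qed simp
    also have "\<dots> = steepness t * l1_norm_vec (g t)"
      by (simp add: l1_norm_sum g_dim[OF tT] sum_distrib_left)
    finally show False using steepness_eq[OF tT] by simp
  qed
  then obtain i where i: "i < n" "g t $ i \<noteq> 0" "steepness t * \<bar>g t $ i\<bar> \<le> - (s i * g t $ i)"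
    by blast
  have "- (s i * g t $ i) \<le> \<bar>s i\<bar> * \<bar>g t $ i\<bar>"
    using abs_ge_minus_self[of "s i * g t $ i"] by (simp add: abs_mult)
  then have "steepness t * \<bar>g t $ i\<bar> \<le> \<bar>s i\<bar> * \<bar>g t $ i\<bar>" using i(3) by linarith
  then have si: "steepness t \<le> \<bar>s i\<bar>" using i(2) by simp
  have "x k $ i = x t' $ i" if k: "t' \<le> k" "k \<le> T" for k
  proof (rule ccontr)
    assume ne: "x k $ i \<noteq> x t' $ i"
    have xk: "feasible (x k)" using feasible_iterate k(2) .
    note [simp] = feasible_dim[OF xk] feasible_dim[OF x']
    have "i \<in> supp_vec (x k - x t')" using ne i(1) by (simp add: supp_vec_def)
    then obtain h where h: "h \<in> elementary_vectors (mat_kernel A)" "conformal h (x k - x t')"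
        "i \<in> supp_vec h"
      using ex_conformal_elementary feasible_diff[OF x' xk] by blast
    have hdim [simp]: "dim_vec h = n" using elementaryD(2)[OF h(1)] .
    have forward: "allowed (x t') h" using conformal_diff_allowed[OF x' xk h(2) hdim] .
    have "conformal (- 1 \<cdot>\<^sub>v h) (x t' - x k)"
      unfolding conformal_def
    proof (intro allI impI)
      fix j assume j: "j < dim_vec (- 1 \<cdot>\<^sub>v h)" "(- 1 \<cdot>\<^sub>v h) $ j \<noteq> 0"
      then have "0 < h $ j * (x k $ j - x t' $ j)" using h(2) by (simp add: conformal_def)
      then show "0 < (- 1 \<cdot>\<^sub>v h) $ j * (x t' - x k) $ j" using j by (simp add: algebra_simps)
    qed
    \<comment> \<open>Contradictory estimates of the cost of \<open>h\<close>: seen from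
      \<open>x t'\<close> it is large because of the reduced cost at \<open>i\<close>, while its
      reverse being allowed at \<open>x k\<close> makes it small.\<close>
    then have backward: "allowed (x k) (- 1 \<cdot>\<^sub>v h)" using conformal_diff_allowed[OF xk x'] by simp
    have neg: "- 1 \<cdot>\<^sub>v h \<in> elementary_vectors (mat_kernel A)" using smult_elementary[OF h(1)] by simp
    have "- (c \<bullet> (- 1 \<cdot>\<^sub>v h)) \<le> steepness t' * l1_norm_vec (- 1 \<cdot>\<^sub>v h)"
      using steepness_bound_later[OF t(2) k] neg backward by (simp add: steepness_bound_def)
    then have ch: "c \<bullet> h \<le> steepness t' * l1_norm_vec h"
      by (simp add: scalar_prod_sum[of _ n] l1_norm_sum sum_negf)
    have hi: "\<bar>h $ i\<bar> > 0" using h(3) by (simp add: supp_vec_def)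
    have l1h: "l1_norm_vec h \<le> real n * \<kappa> * \<bar>h $ i\<bar>" by (rule l1_norm_elementary_le_dim[OF h(1,3)])
    have nk: "1 \<le> real n * \<kappa>"
      using n_pos circuit_imbalance_ge_1 mult_mono[of 1 "real n" 1 \<kappa>] by simp
    have e': "steepness t' > 0" by (rule steepness_pos[OF t(2)])
    have "steepness t' * 1 \<le> steepness t' * (2 * real n * \<kappa>)"
      using nk e' by (intro mult_left_mono) auto
    then have lt: "steepness t' < steepness t" using drop by (simp add: algebra_simps)
    have coord: "- (s j * h $ j) \<le> steepness t' * \<bar>h $ j\<bar>" if "j < n" for j
      by (rule dual_certificate_coord[OF s x' forward that])
    have "\<bar>s i * h $ i\<bar> \<ge> steepness t * \<bar>h $ i\<bar>"
      using si hi by (simp add: abs_mult)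
    moreover have "steepness t' * \<bar>h $ i\<bar> < steepness t * \<bar>h $ i\<bar>" using lt hi by simp
    \<comment> \<open>The certificate excludes a strongly negative \<open>s i * h $ i\<close>, so
      the large absolute value belongs to a positive number.\<close>
    ultimately have big: "s i * h $ i \<ge> steepness t * \<bar>h $ i\<bar>" using coord[OF i(1)] by linarith
    have "(\<Sum>j\<in>{..<n} - {i}. - (s j * h $ j)) \<le> (\<Sum>j\<in>{..<n} - {i}. steepness t' * \<bar>h $ j\<bar>)"
      by (intro sum_mono coord) auto
    also have "\<dots> \<le> (\<Sum>j<n. steepness t' * \<bar>h $ j\<bar>)"
      using e' by (intro sum_mono2) auto
    also have "\<dots> = steepness t' * l1_norm_vec h" by (simp add: l1_norm_sum sum_distrib_left)
    finally have rest: "- (steepness t' * l1_norm_vec h) \<le> (\<Sum>j\<in>{..<n} - {i}. s j * h $ j)"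
      by (simp add: sum_negf)
    have "c \<bullet> h = s i * h $ i + (\<Sum>j\<in>{..<n} - {i}. s j * h $ j)"
      using s elementaryD(1)[OF h(1)] i(1)
      by (simp add: dual_certificate_def sum.remove[of "{..<n}" i])
    then have "steepness t * \<bar>h $ i\<bar> \<le> 2 * (steepness t' * l1_norm_vec h)"
      using big rest ch by linarith
    also have "\<dots> \<le> 2 * (steepness t' * (real n * \<kappa> * \<bar>h $ i\<bar>))"
      using l1h e' by (intro mult_left_mono) auto
    also have "\<dots> = (2 * real n * \<kappa> * steepness t') * \<bar>h $ i\<bar>" by (simp add: algebra_simps)
    finally show False using drop hi by simp
  qed
  then show ?thesis using i(1,2) by blast
qed

text \<open>Within \<open>k * n\<close> steps the steepness drops enough to freeze a coordinate
  still moving at the start of the block; \<open>n + 1\<close> blocks would freeze more than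
  \<open>n\<close> coordinates.\<close>

lemma run_length_le:
  assumes k: "(1 - contraction) ^ k * (2 * real n * \<kappa>) < 1"
  shows "T \<le> Suc n * (k * n)"
proof (rule ccontr)
  assume "\<not> T \<le> Suc n * (k * n)"
  then have long: "Suc n * (k * n) < T" by simp
  define F where "F t = {i. i < n \<and> (\<forall>l. t \<le> l \<and> l \<le> T \<longrightarrow> x l $ i = x t $ i)}" for t
  have fin: "finite (F t)" for t by (simp add: F_def)
  have grow: "F t \<subset> F (t + k * n)" if t: "t + k * n < T" for t
  proof -
    have tT: "t < T" using t by simp
    have nk: "2 * real n * \<kappa> \<ge> 0" using circuit_imbalance_ge_1 by simp
    have "2 * real n * \<kappa> * steepness (t + k * n)
        \<le> 2 * real n * \<kappa> * ((1 - contraction) ^ k * steepness t)"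
      by (intro mult_left_mono steepness_contracts_power t nk)
    also have "\<dots> = ((1 - contraction) ^ k * (2 * real n * \<kappa>)) * steepness t" by simp
    also have "\<dots> < steepness t" using k steepness_pos[OF tT] by simp
    finally obtain i where i: "i < n" "g t $ i \<noteq> 0"
        "\<forall>l. t + k * n \<le> l \<and> l \<le> T \<longrightarrow> x l $ i = x (t + k * n) $ i"
      using coordinate_frozen[of t "t + k * n"] t by auto
    obtain \<alpha> where "\<alpha> > 0" "x (Suc t) $ i = x t $ i + \<alpha> * g t $ i"
      using iterate_coord[OF tT] i(1) by metis
    \<comment> \<open>The coordinate just frozen was moved by step \<open>t\<close>, so it is
      new.\<close>
    then have "x (Suc t) $ i \<noteq> x t $ i" using i(2) by simp
    then have "i \<notin> F t" using tT by (auto simp: F_def intro!: exI[of _ "Suc t"])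
    moreover have "i \<in> F (t + k * n)" using i unfolding F_def by blast
    moreover have "F t \<subseteq> F (t + k * n)"
    proof
      fix j assume "j \<in> F t"
      then have j: "j < n" "\<And>l. t \<le> l \<Longrightarrow> l \<le> T \<Longrightarrow> x l $ j = x t $ j"
        unfolding F_def by blast+
      have "x l $ j = x (t + k * n) $ j" if "t + k * n \<le> l" "l \<le> T" for l
        using j(2)[of l] j(2)[of "t + k * n"] that t by linarith
      then show "j \<in> F (t + k * n)" using j(1) unfolding F_def by blast
    qed
    ultimately show ?thesis by blast
  qed
  have "j \<le> card (F (j * (k * n)))" if "j \<le> Suc n" for j
    using that
  proof (induction j)
    case (Suc j)
    have "Suc j * (k * n) \<le> Suc n * (k * n)" using Suc.prems by (intro mult_right_mono) auto
    also note long
    finally have "j * (k * n) + k * n < T" by (simp add: add.commute)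
    then have "card (F (j * (k * n))) < card (F (j * (k * n) + k * n))"
      by (intro psubset_card_mono grow fin)
    then show ?case using Suc by (simp add: add.commute)
  qed simp
  from this[of "Suc n"] have "Suc n \<le> card (F (Suc n * (k * n)))" by simp
  also have "\<dots> \<le> card {..<n}" by (intro card_mono) (auto simp: F_def)
  finally show False by simp
qed

lemma run_length_bound:
  assumes m: "1 \<le> m"
  shows "real T \<le> 12 * (real n)\<^sup>2 * real m * \<kappa> * ln (\<kappa> + real n)"
proof -
  let ?L = "ln (\<kappa> + real n)"
  note \<kappa> = circuit_imbalance_ge_1
  have n: "1 \<le> real n" and m': "1 \<le> real m" using n_pos m by auto
  have mk: "1 \<le> real m * \<kappa>" using mult_mono[of 1 "real m" 1 \<kappa>] m' \<kappa> by simp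
  have nk: "1 \<le> real n * \<kappa>" using mult_mono[of 1 "real n" 1 \<kappa>] n \<kappa> by simp
  \<comment> \<open>Since \<open>1 - contraction\<close> is at most
    \<open>exp (- contraction)\<close>, any \<open>k\<close> above this product suffices; the
    successor of the floor makes the inequality strict.\<close>
  define k where "k = Suc (nat \<lfloor>(1 + real m * \<kappa>) * ln (2 * real n * \<kappa>)\<rfloor>)"
  have ln_nonneg: "ln (2 * real n * \<kappa>) \<ge> 0" using nk by (intro ln_ge_zero) simp
  then have prod_nonneg: "(1 + real m * \<kappa>) * ln (2 * real n * \<kappa>) \<ge> 0"
    using mk by (intro mult_nonneg_nonneg) auto
  have k_gt: "(1 + real m * \<kappa>) * ln (2 * real n * \<kappa>) < real k"
    and k_le: "real k \<le> (1 + real m * \<kappa>) * ln (2 * real n * \<kappa>) + 1"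
    unfolding k_def using prod_nonneg by linarith+
  have "ln (2 * real n * \<kappa>) < real k * contraction"
    using k_gt mk by (simp add: contraction_def pos_less_divide_eq mult.commute)
  have "(1 - contraction) ^ k \<le> exp (- contraction) ^ k"
    using contraction_bounds exp_ge_add_one_self[of "- contraction"] by (intro power_mono) auto
  also have "\<dots> = exp (- (real k * contraction))" by (simp flip: exp_of_nat_mult)
  also have "\<dots> < exp (- ln (2 * real n * \<kappa>))"
    using \<open>ln (2 * real n * \<kappa>) < real k * contraction\<close> by simp
  also have "\<dots> = 1 / (2 * real n * \<kappa>)" using nk by (simp add: exp_minus field_simps)
  finally have "(1 - contraction) ^ k * (2 * real n * \<kappa>) < 1"
    using nk by (simp add: pos_less_divide_eq)
  then have T: "T \<le> Suc n * (k * n)" by (rule run_length_le)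
  \<comment> \<open>A positive lower bound on the logarithm is needed to absorb the rounding term 1
    in \<open>k_le\<close>.\<close>
  have ln2: "1 / 2 \<le> ln (2::real)" using ln_le_minus_one[of "1 / 2"] by (simp add: ln_div)
  have "2 \<le> \<kappa> + real n" using \<kappa> n by simp
  then have "ln 2 \<le> ?L" by (intro ln_mono) auto
  with ln2 have L: "1 / 2 \<le> ?L" by linarith
  \<comment> \<open>Replacing the product by the square of the sum costs only a factor 2 after
    taking logarithms.\<close>
  have "2 * real n * \<kappa> \<le> (\<kappa> + real n)\<^sup>2" by (simp add: power2_eq_square algebra_simps)
  then have "ln (2 * real n * \<kappa>) \<le> ln ((\<kappa> + real n)\<^sup>2)" using nk by (intro ln_mono) auto
  also have "\<dots> = 2 * ?L" using \<kappa> n by (simp add: ln_realpow)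
  finally have ln_le: "ln (2 * real n * \<kappa>) \<le> 2 * ?L" .
  have "1 \<le> (2 * ?L) * (real m * \<kappa>)"
    using mult_mono[of 1 "2 * ?L" 1 "real m * \<kappa>"] L mk by simp
  have "(1 + real m * \<kappa>) * ln (2 * real n * \<kappa>) \<le> (2 * (real m * \<kappa>)) * (2 * ?L)"
    using mk ln_le ln_nonneg by (intro mult_mono) auto
  \<comment> \<open>The product contributes 4 and the rounding 2; bounding \<open>n + 1\<close> by
    \<open>2 * n\<close> below doubles the resulting 6 to the final 12.\<close>
  with k_le \<open>1 \<le> (2 * ?L) * (real m * \<kappa>)\<close>
  have k_bound: "real k \<le> 6 * (real m * \<kappa> * ?L)" by (simp add: algebra_simps)
  have "real T \<le> real (Suc n * (k * n))" using T by (simp only: of_nat_le_iff)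
  also have "\<dots> = (1 + real n) * real n * real k" by (simp add: algebra_simps)
  also have "\<dots> \<le> (2 * real n * real n) * (6 * (real m * \<kappa> * ?L))"
    using n k_bound by (intro mult_mono mult_right_mono) auto
  finally show ?thesis by (simp add: power2_eq_square mult_ac)
qed

end

text \<open>Termination is expressed by a length bound for every run together with progress: the
  last iterate admits a further step or is optimal. The constant is quantified before all data, so
  it is absolute.\<close>

theorem theorem8p4:
  shows "\<exists>C::real. C > 0 \<and>
    (\<forall>(m::nat) (n::nat) (A::real mat) (b::real vec) (c::real vec) (u::real vec) (x0::real vec).
       m \<ge> 1 \<and> n \<ge> 1 \<and> A \<in> carrier_mat m n \<and>
       b \<in> carrier_vec m \<and> c \<in> carrier_vec n \<and> u \<in> carrier_vec n \<and>
       lp_feasible A b u x0 \<longrightarrow>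
       (\<forall>(x::nat \<Rightarrow> real vec) (T::nat).
          x 0 = x0 \<and> steepest_descent_run A b c u x T \<longrightarrow>
            real T \<le> C * (real n)\<^sup>2 * real m * circuit_imbalance_mat A
                      * ln (circuit_imbalance_mat A + real n) \<and>
            (if \<exists>g. augmenting_direction A c u (x T) g
             then \<exists>y. steepest_descent_step A b c u (x T) y
             else lp_optimal A b c u (x T))))"
proof (intro exI[of _ "12::real"] conjI allI impI)
  fix m n :: nat and A :: "real mat" and b c u x0 :: "real vec" and x :: "nat \<Rightarrow> real vec" and T :: nat
  assume hyp: "m \<ge> 1 \<and> n \<ge> 1 \<and> A \<in> carrier_mat m n \<and>
       b \<in> carrier_vec m \<and> c \<in> carrier_vec n \<and> u \<in> carrier_vec n \<and> lp_feasible A b u x0"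
    and run: "x 0 = x0 \<and> steepest_descent_run A b c u x T"
  interpret bounded_lp m n A b c u by unfold_locales (use hyp in auto)
  have step: "steepest_descent_step A b c u (x t) (x (Suc t))" if "t < T" for t
    using run that by (simp add: steepest_descent_run_def)
  have feas: "feasible (x t)" if "t \<le> T" for t
    using that
  proof (induction t)
    case 0
    then show ?case using hyp run by simp
  next
    case (Suc t)
    then show ?case using step[of t] by (auto elim!: steepest_descent_stepE[rotated])
  qed
  \<comment> \<open>Bundling all properties of a direction lets the directions of all steps be
    chosen at once.\<close>
  define good where "good t d \<longleftrightarrow> d \<in> elementary_vectors (mat_kernel A) \<and> allowed (x t) d \<and> c \<bullet> d < 0 \<and>
      steepness_bound (x t) (- (c \<bullet> d) / l1_norm_vec d) \<and> (\<exists>\<alpha>>0. x (Suc t) = x t + \<alpha> \<cdot>\<^sub>v d) \<and>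
      (\<exists>i<n. d $ i > 0 \<and> x (Suc t) $ i = u $ i \<or> d $ i < 0 \<and> x (Suc t) $ i = 0)" for t d
  have "\<exists>d. good t d" if "t < T" for t
    using steepest_descent_stepE[OF feas step[OF that]] that unfolding good_def
    by (metis less_imp_le)
  then obtain g where g: "\<And>t. t < T \<Longrightarrow> good t (g t)" by metis
  interpret steepest_descent_iterates m n A b c u x T g
    by unfold_locales (use g hyp feas in \<open>auto simp: good_def\<close>)
  have "circuit_imbalance_mat A = circuit_imbalance n (mat_kernel A)"
    using hyp by (auto simp: circuit_imbalance_mat_def)
  then show "real T \<le> 12 * (real n)\<^sup>2 * real m * circuit_imbalance_mat A
      * ln (circuit_imbalance_mat A + real n)"
    using run_length_bound hyp by simp
  show "if \<exists>g. augmenting_direction A c u (x T) g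
    then \<exists>y. steepest_descent_step A b c u (x T) y else lp_optimal A b c u (x T)"
    using ex_steepest_descent_step[OF feas] no_augmenting_imp_optimal[OF feas] by auto
qed simp

end
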